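(* Let $c_1=\frac{40001}{80000}$, let $n\ge 400001$ be odd and let $p\in\{0,1\}$. Every relaxed $p$-cover $C$ of the queen's graph $Q_n$ satisfies $$|C|>c_1(n-1)-\frac15 .$$
   Context: The queen's graph $Q_n$ has as vertices the squares $(x,y)\in\{0,\ldots,n-1\}^2$ of the $n\times n$ chessboard ($x$ is the column, $y$ the row); two distinct squares are adjacent if they share a row, a column, or a diagonal ($y-x$ equal or $x+y$ equal). A set $C$ of squares (queens) is a dominating set if every square belongs to $C$ or is adjacent to a square of $C$. A row or column is occupied if it contains a queen of $C$. For $p\in\{0,1\}$, a dominating set $C$ is a relaxed $p$-cover if every column and every row whose index has parity $p$ is occupied. Queens may attack one another. *)

theory Defs
  imports Complex_Main
begin

text \<open>
  A square is a pair (x, y) with x the column and y the row.  Coordinates are integers so that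
  the difference y - x is a genuine (untruncated) difference.
\<close>

type_synonym square = "int \<times> int"

definition squares :: "nat \<Rightarrow> square set" where
  "squares n = {0..<int n} \<times> {0..<int n}"

definition queen_adj :: "nat \<Rightarrow> square \<Rightarrow> square \<Rightarrow> bool" where
  "queen_adj n s t \<longleftrightarrow>
     s \<in> squares n \<and> t \<in> squares n \<and> s \<noteq> t \<and>
     (fst s = fst t \<or> snd s = snd t \<or>
      snd s - fst s = snd t - fst t \<or> fst s + snd s = fst t + snd t)"

definition dominating_set :: "'v set \<Rightarrow> ('v \<Rightarrow> 'v \<Rightarrow> bool) \<Rightarrow> 'v set \<Rightarrow> bool" where
  "dominating_set V adj C \<longleftrightarrow> C \<subseteq> V \<and> (\<forall>v\<in>V. v \<in> C \<or> (\<exists>c\<in>C. adj v c))"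

definition column_occupied :: "square set \<Rightarrow> int \<Rightarrow> bool" where
  "column_occupied C x \<longleftrightarrow> (\<exists>y. (x, y) \<in> C)"

definition row_occupied :: "square set \<Rightarrow> int \<Rightarrow> bool" where
  "row_occupied C y \<longleftrightarrow> (\<exists>x. (x, y) \<in> C)"

text \<open>The parity restriction applies to columns and rows alike.\<close>

definition relaxed_cover :: "nat \<Rightarrow> int \<Rightarrow> square set \<Rightarrow> bool" where
  "relaxed_cover n p C \<longleftrightarrow>
     dominating_set (squares n) (queen_adj n) C \<and>
     (\<forall>x\<in>{0..<int n}. x mod 2 = p \<longrightarrow> column_occupied C x) \<and>
     (\<forall>y\<in>{0..<int n}. y mod 2 = p \<longrightarrow> row_occupied C y)"

definition c1 :: real where
  "c1 = 40001 / 80000"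

end

theory Submission
  imports Defs
begin

text \<open>
  Centre the board, so that coordinates run from \<open>-h\<close> to \<open>h\<close> with \<open>n = 2 h + 1\<close>, and let \<open>e\<close> be the parity
  of the lines that have to be occupied. There are at least \<open>h\<close> such columns and as many such rows, so a
  cover with \<open>h + k\<close> queens has at most \<open>k\<close> queens on columns of the other parity, and at most \<open>k\<close> on rows
  of the other parity. The claim is that \<open>k\<close> exceeds \<open>h/40000\<close>.

  A square \<open>(x, y)\<close> with both coordinates of the wrong parity almost always lies on empty lines, hence on an
  occupied difference diagonal \<open>d = y - x\<close> or sum diagonal \<open>s = x + y\<close>. On these squares \<open>d\<close> and \<open>s\<close> are even
  and \<open>d + s = 2 y\<close>, so the class of \<open>d\<close> modulo 4 fixes that of \<open>s\<close>. If \<open>d\<close> is the empty diagonal of its class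
  that is nearest to the centre, all its squares need their sum diagonals: nearly all sum diagonals
  with \<open>|s| < 2 h - |d|\<close> in the partner class are occupied. About \<open>h\<close> queens can only just afford that, which
  leaves no freedom but one number (lemma \<open>occupied_radii\<close>): up to an error proportional to \<open>k\<close>, one class of
  differences and one class of sums are occupied exactly for \<open>|t| < R\<^sub>0\<close>, the other two classes exactly for
  \<open>|t| < R\<^sub>2\<close>, where \<open>R\<^sub>0 + R\<^sub>2\<close> is close to \<open>2 h\<close> and \<open>R\<^sub>2 \<le> R\<^sub>0\<close>. Queens with both coordinates of parity \<open>e\<close> use
  either both wide classes or both narrow classes.

  It remains to see that no arrangement of queens has these line counts, and this is done by linear
  programming duality. Give nonnegative weights to columns, rows and diagonals so that the four lines through
  any square weigh at most \<open>\<kappa>\<close> together. Then the lines known to be occupied weigh at most \<open>\<kappa>\<close> times the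
  number of queens, up to an error proportional to \<open>k\<close> (lemma \<open>weighted_count\<close>). Two systems of weights are
  used.

  The parallelogram law \<open>2 x\<^sup>2 + 2 y\<^sup>2 = d\<^sup>2 + s\<^sup>2\<close>, read in both directions, gives weights that pin down
  the ratio \<open>\<rho> = R\<^sub>0 / (2 h)\<close>: approximately \<open>\<rho>\<^sup>3 + (1 - \<rho>)\<^sup>3 = 1/2\<close>, so \<open>\<rho>\<close> is near \<open>0.7887\<close>. At this ratio the
  second moments agree, so these weights give no contradiction. The second system, scaled by \<open>W = R\<^sub>0 / 2\<close>, consists
  of the piecewise quadratic potentials below, a rational approximation to an optimal dual solution; their
  pieces are chosen so that each case of the bound \<open>56\<close> on the weight of a square is again a parallelogram law
  (lemmas \<open>wide_potential_balance\<close> and \<open>narrow_potential_balance\<close>). The occupied lines would weigh about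
  \<open>56 h + h (28 - 203/6 \<rho> - 84 (1 - \<rho>)\<^sup>3 / \<rho>\<^sup>2)\<close>, and the bracket is at least \<open>0.035\<close> for every ratio that the
  parallelogram law permits (lemma \<open>potential_gap\<close>). So \<open>k\<close> is at least a fixed proportion of \<open>h\<close>.
\<close>

section \<open>Sums over residue classes\<close>

definition progression :: "int \<Rightarrow> int \<Rightarrow> real \<Rightarrow> real \<Rightarrow> int set" where
  "progression w c l r = {t. t mod w = c \<and> l < of_int t \<and> of_int t < r}"

lemma finite_progression [simp]: "finite (progression w c l r)"
proof (rule finite_subset)
  show "progression w c l r \<subseteq> {\<lfloor>l\<rfloor>..\<lceil>r\<rceil>}"
  proof
    fix t assume "t \<in> progression w c l r"
    hence "l < of_int t" "of_int t < r" by (simp_all add: progression_def)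
    hence "\<lfloor>l\<rfloor> \<le> t" "t \<le> \<lceil>r\<rceil>" by linarith+
    thus "t \<in> {\<lfloor>l\<rfloor>..\<lceil>r\<rceil>}" by simp
  qed
qed simp

lemma residue_in_block:
  fixes w c :: int and x :: real
  assumes "w > 0" "0 \<le> c" "c < w"
  obtains t where "{t. t mod w = c \<and> x < of_int t \<and> of_int t \<le> x + of_int w} = {t}"
    and "x < of_int t" "of_int t \<le> x + of_int w"
proof -
  define j where "j = \<lfloor>(x - c) / w\<rfloor> + 1"
  define t where "t = c + w * j"
  have w: "real_of_int w > 0" using assms by simp
  have "(x - c) / w < of_int j" "of_int j \<le> (x - c) / w + 1"
    unfolding j_def by linarith+
  hence "x - c < of_int j * of_int w" "of_int j * of_int w \<le> x - c + w"
    using w by (simp_all add: field_simps)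
  hence t: "x < of_int t" "of_int t \<le> x + of_int w"
    by (simp_all add: t_def algebra_simps)
  have tm: "t mod w = c" using assms by (simp add: t_def)
  have unique: "s = t" if "s mod w = c" "x < of_int s" "of_int s \<le> x + of_int w" for s
  proof -
    have "w dvd s - t" using that(1) tm by (metis mod_eq_dvd_iff)
    moreover have "\<bar>s - t\<bar> < w" using t that(2,3) by linarith
    ultimately show ?thesis
      using assms(1) by (metis abs_of_pos dvd_imp_le_int eq_iff_diff_eq_0 not_le)
  qed
  have "{t. t mod w = c \<and> x < of_int t \<and> of_int t \<le> x + of_int w} = {t}"
    using t tm unique by blast
  thus thesis using t by (rule that)
qed

text \<open>
  Every block of \<open>w\<close> consecutive integers contains one point of the residue class, and by the mean value
  theorem the integral over the block is \<open>w\<close> times some value of \<open>f\<close>; the two values of \<open>f\<close> differ by at most \<open>L\<close>.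
\<close>

lemma sum_blocks_ge:
  fixes w c :: int and f F :: "real \<Rightarrow> real" and l L :: real and N :: nat
  assumes w: "w > 0" "0 \<le> c" "c < w"
    and deriv: "\<And>x. (F has_real_derivative f x) (at x)"
    and osc: "\<And>x y :: real. \<lbrakk>l \<le> x; l \<le> y; x \<le> l + w * N; y \<le> l + w * N; \<bar>x - y\<bar> \<le> w\<rbrakk> \<Longrightarrow> f x \<le> f y + L"
  shows "F (l + w * N) - F l - w * (N * L)
      \<le> w * (\<Sum>t\<in>{t. t mod w = c \<and> l < of_int t \<and> of_int t \<le> l + w * N}. f (of_int t))"
  using osc
proof (induction N)
  case 0
  have empty: "{t. t mod w = c \<and> l < of_int t \<and> of_int t \<le> l} = {}" by auto
  show ?case by (simp add: empty)
next
  case (Suc N)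
  define x where "x = l + w * N"
  have wp: "real_of_int w > 0" using w by simp
  have xs: "l + w * Suc N = x + w" by (simp add: x_def algebra_simps)
  have xl: "l \<le> x" using wp by (simp add: x_def)
  let ?P = "{t. t mod w = c \<and> l < of_int t \<and> of_int t \<le> x}"
  obtain t where t: "{t. t mod w = c \<and> x < of_int t \<and> of_int t \<le> x + of_int w} = {t}"
    and tx: "x < of_int t" "of_int t \<le> x + of_int w"
    by (rule residue_in_block[OF w, of x])
  have split: "{t. t mod w = c \<and> l < of_int t \<and> of_int t \<le> x + w} = insert t ?P" (is "?Q = _")
  proof -
    have "?Q = ?P \<union> {t. t mod w = c \<and> x < of_int t \<and> of_int t \<le> x + of_int w}"
      using xl wp by auto
    thus ?thesis using t by auto
  qed
  have fin: "finite ?P"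
    by (rule finite_subset[OF _ finite_progression[of w c l "x + 1"]]) (auto simp: progression_def)
  have notin: "t \<notin> ?P" using tx by auto
  obtain z where z: "x < z" "z < x + w" "F (x + w) - F x = (x + w - x) * f z"
    using MVT2[of x "x + w" F f] deriv wp by auto
  have "f z \<le> f (of_int t) + L"
    by (rule Suc.prems) (use z tx xl xs in \<open>auto simp: abs_le_iff\<close>)
  hence "w * f z \<le> w * (f (of_int t) + L)" using wp by (intro mult_left_mono) auto
  hence step: "F (x + w) - F x \<le> w * f (of_int t) + w * L"
    using z(3) by (simp add: algebra_simps)
  have "F x - F l - w * (N * L) \<le> w * (\<Sum>t\<in>?P. f (of_int t))"
    unfolding x_def
  proof (rule Suc.IH)
    fix a b assume ab: "l \<le> a" "l \<le> b" "a \<le> l + w * N" "b \<le> l + w * N" "\<bar>a - b\<bar> \<le> w"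
    have "l + w * N \<le> l + w * Suc N" using wp by (simp add: algebra_simps)
    with ab show "f a \<le> f b + L" by (intro Suc.prems) auto
  qed
  with step have "F (x + w) - F l - w * (Suc N * L) \<le> w * (f (of_int t) + (\<Sum>t\<in>?P. f (of_int t)))"
    by (simp add: algebra_simps)
  also have "\<dots> = w * (\<Sum>t\<in>insert t ?P. f (of_int t))"
    using fin notin by simp
  finally show ?case unfolding xs split .
qed

text \<open>
  Weights are only ever needed on many lines, so sums over residue classes are compared with integrals.
  Only lower bounds matter: the weight of the occupied lines is what the queens have to pay for.
\<close>

lemma sum_progression_ge:
  fixes w c :: int and f F :: "real \<Rightarrow> real" and l r L M :: real
  assumes w: "w > 0" "0 \<le> c" "c < w" and "l \<le> r"
    and deriv: "\<And>x. (F has_real_derivative f x) (at x)"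
    and osc: "\<And>x y :: real. \<lbrakk>l \<le> x; l \<le> y; x \<le> r; y \<le> r; \<bar>x - y\<bar> \<le> w\<rbrakk> \<Longrightarrow> f x \<le> f y + L * w"
    and nonneg: "\<And>x. \<lbrakk>l \<le> x; x \<le> r\<rbrakk> \<Longrightarrow> 0 \<le> f x"
    and le: "\<And>x. \<lbrakk>l \<le> x; x \<le> r\<rbrakk> \<Longrightarrow> f x \<le> M"
    and "L \<ge> 0"
  shows "F r - F l - w * (L * (r - l) + M) \<le> w * (\<Sum>t\<in>progression w c l r. f (of_int t))"
proof (cases "l = r")
  case True
  have "progression w c l r = {}" using True by (auto simp: progression_def)
  moreover have "M \<ge> 0" using nonneg[of l] le[of l] \<open>l \<le> r\<close> by linarith
  ultimately show ?thesis using True w by simp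
next
  case False
  with \<open>l \<le> r\<close> have lr: "l < r" by simp
  have wp: "real_of_int w > 0" using w by simp
  have M: "M \<ge> 0" using nonneg[of l] le[of l] lr by linarith
  \<comment> \<open>whole blocks that end strictly before \<open>r\<close>; what is left is at most one block and costs \<open>w * M\<close>\<close>
  define N where "N = nat (\<lceil>(r - l) / w\<rceil> - 1)"
  have "(r - l) / w > 0" using lr wp by simp
  hence "real N = of_int \<lceil>(r - l) / w\<rceil> - 1" by (simp add: N_def)
  hence N: "real N < (r - l) / w" "(r - l) / w \<le> real N + 1" by linarith+
  define x where "x = l + w * N"
  have x: "l \<le> x" "x < r" "r \<le> x + w"
    using N wp by (simp_all add: x_def field_simps)
  have "F x - F l - w * (N * (L * w)) \<le> w * (\<Sum>t\<in>{t. t mod w = c \<and> l < of_int t \<and> of_int t \<le> x}. f (of_int t))"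
    unfolding x_def by (rule sum_blocks_ge[OF w deriv]) (use x osc in \<open>auto simp: x_def\<close>)
  also have "\<dots> \<le> w * (\<Sum>t\<in>progression w c l r. f (of_int t))"
  proof (intro mult_left_mono sum_mono2)
    show "{t. t mod w = c \<and> l < of_int t \<and> of_int t \<le> x} \<subseteq> progression w c l r"
      using x by (auto simp: progression_def)
    show "0 \<le> f (of_int t)" if "t \<in> progression w c l r - {t. t mod w = c \<and> l < of_int t \<and> of_int t \<le> x}" for t
      using that by (intro nonneg) (auto simp: progression_def)
  qed (use wp in auto)
  finally have 1: "F x - F l - w * (N * (L * w)) \<le> w * (\<Sum>t\<in>progression w c l r. f (of_int t))" .
  obtain z where z: "x < z" "z < r" "F r - F x = (r - x) * f z"
    using MVT2[of x r F f] deriv x by auto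
  have "(r - x) * f z \<le> w * M"
    using x z wp le nonneg by (intro mult_mono) auto
  with z have 2: "F r - F x \<le> w * M" by simp
  have "L * (N * w) \<le> L * (r - l)"
    using x \<open>L \<ge> 0\<close> by (intro mult_left_mono) (auto simp: x_def algebra_simps)
  hence 3: "w * (N * (L * w)) \<le> w * (L * (r - l))"
    using wp by (intro mult_left_mono) (auto simp: algebra_simps)
  from 1 2 3 show ?thesis by (simp add: algebra_simps)
qed

lemma sum_quadratic_progression_ge:
  fixes w c :: int and l r W \<tau> \<alpha> \<beta> :: real
  assumes w: "w > 0" "0 \<le> c" "c < w" and "l \<le> r" and W: "W > 0"
    and range: "\<bar>l / W - \<tau>\<bar> \<le> 1" "\<bar>r / W - \<tau>\<bar> \<le> 1"
    and nonneg: "\<And>t. \<lbrakk>l \<le> t; t \<le> r\<rbrakk> \<Longrightarrow> 0 \<le> \<alpha> + \<beta> * (t / W - \<tau>)\<^sup>2"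
  shows "\<alpha> * (r - l) + \<beta> * W / 3 * ((r / W - \<tau>) ^ 3 - (l / W - \<tau>) ^ 3)
           - w * (2 * \<bar>\<beta>\<bar> / W * (r - l) + (\<bar>\<alpha>\<bar> + \<bar>\<beta>\<bar>))
       \<le> w * (\<Sum>t\<in>progression w c l r. \<alpha> + \<beta> * (of_int t / W - \<tau>)\<^sup>2)"
proof -
  define f where "f = (\<lambda>t. \<alpha> + \<beta> * (t / W - \<tau>)\<^sup>2)"
  define F where "F = (\<lambda>t. \<alpha> * t + \<beta> * W / 3 * (t / W - \<tau>) ^ 3)"
  have near: "\<bar>t / W - \<tau>\<bar> \<le> 1" if "l \<le> t" "t \<le> r" for t
  proof -
    have "l / W \<le> t / W" "t / W \<le> r / W" using that W by (simp_all add: divide_right_mono)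
    with range show ?thesis by linarith
  qed
  have "F r - F l - w * ((2 * \<bar>\<beta>\<bar> / W) * (r - l) + (\<bar>\<alpha>\<bar> + \<bar>\<beta>\<bar>)) \<le> w * (\<Sum>t\<in>progression w c l r. f (of_int t))"
  proof (rule sum_progression_ge[where f = f and F = F, OF w \<open>l \<le> r\<close>])
    show "(F has_real_derivative f x) (at x)" for x
      unfolding F_def f_def using W
      by (auto intro!: derivative_eq_intros simp: power2_eq_square)
    show "f x \<le> f y + 2 * \<bar>\<beta>\<bar> / W * w"
      if "l \<le> x" "l \<le> y" "x \<le> r" "y \<le> r" "\<bar>x - y\<bar> \<le> w" for x y
    proof -
      have "f x - f y = \<beta> * ((x - y) / W) * ((x / W - \<tau>) + (y / W - \<tau>))"
        by (simp add: f_def algebra_simps power2_eq_square diff_divide_distrib)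
      also have "\<dots> \<le> \<bar>\<beta> * ((x - y) / W) * ((x / W - \<tau>) + (y / W - \<tau>))\<bar>" by (rule abs_ge_self)
      also have "\<dots> = \<bar>\<beta>\<bar> * (\<bar>x - y\<bar> / W) * \<bar>(x / W - \<tau>) + (y / W - \<tau>)\<bar>"
        using W by (simp add: abs_mult)
      also have "\<dots> \<le> \<bar>\<beta>\<bar> * (w / W) * 2"
        using W that near[of x] near[of y] w
        by (intro mult_mono mult_left_mono divide_right_mono) auto
      finally show ?thesis by (simp add: algebra_simps)
    qed
    show "0 \<le> f x" if "l \<le> x" "x \<le> r" for x using nonneg that by (simp add: f_def)
    show "f x \<le> \<bar>\<alpha>\<bar> + \<bar>\<beta>\<bar>" if "l \<le> x" "x \<le> r" for x
    proof -
      have "(x / W - \<tau>)\<^sup>2 \<le> 1" using near[OF that] by (simp add: abs_square_le_1)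
      hence "\<bar>\<beta>\<bar> * (x / W - \<tau>)\<^sup>2 \<le> \<bar>\<beta>\<bar>" by (simp add: mult_left_le)
      moreover have "\<beta> * (x / W - \<tau>)\<^sup>2 \<le> \<bar>\<beta>\<bar> * (x / W - \<tau>)\<^sup>2"
        by (intro mult_right_mono) auto
      ultimately show ?thesis unfolding f_def by linarith
    qed
    show "0 \<le> 2 * \<bar>\<beta>\<bar> / W" using W by simp
  qed
  thus ?thesis by (simp add: F_def f_def algebra_simps)
qed

lemma card_progression_ge:
  fixes w c :: int and l r :: real
  assumes "w > 0" "0 \<le> c" "c < w"
  shows "r - l - w \<le> w * real (card (progression w c l r))"
proof (cases "l \<le> r")
  case True
  have "F r - F l - w * (0 * (r - l) + 1) \<le> w * (\<Sum>t\<in>progression w c l r. 1 :: real)"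
    if "F = (\<lambda>x. x)" for F :: "real \<Rightarrow> real"
    by (rule sum_progression_ge[where f = "\<lambda>_. 1" and F = F, OF assms True])
       (auto simp: that)
  thus ?thesis by simp
next
  case False
  hence "r - l - w \<le> 0" using assms by simp
  also have "0 \<le> w * real (card (progression w c l r))" using assms by simp
  finally show ?thesis .
qed

lemma sum_progression_split:
  assumes "l \<le> m" "m \<le> r" and "\<And>t. t \<in> progression w c l r \<Longrightarrow> 0 \<le> \<phi> t"
  shows "(\<Sum>t\<in>progression w c l m. \<phi> t) + (\<Sum>t\<in>progression w c m r. \<phi> t)
      \<le> (\<Sum>t\<in>progression w c l r. \<phi> t :: real)"
proof -
  have "(\<Sum>t\<in>progression w c l m. \<phi> t) + (\<Sum>t\<in>progression w c m r. \<phi> t)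
      = (\<Sum>t\<in>progression w c l m \<union> progression w c m r. \<phi> t)"
    by (intro sum.union_disjoint[symmetric] finite_progression) (auto simp: progression_def)
  also have "\<dots> \<le> (\<Sum>t\<in>progression w c l r. \<phi> t)"
    by (intro sum_mono2 finite_progression) (use assms in \<open>auto simp: progression_def\<close>)
  finally show ?thesis .
qed

lemma sum_progression_symmetric:
  assumes c: "(- c) mod w = c" and even: "\<And>t. \<phi> (- t) = \<phi> t"
    and "\<And>t. t \<in> progression w c (- R) R \<Longrightarrow> 0 \<le> \<phi> t" and "R \<ge> 0"
  shows "2 * (\<Sum>t\<in>progression w c 0 R. \<phi> t) \<le> (\<Sum>t\<in>progression w c (- R) R. \<phi> t :: real)"
proof -
  have neg: "(- t) mod w = c" if "t mod w = c" for t
    using that c by (metis mod_minus_eq)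
  have "(\<Sum>t\<in>progression w c (- R) 0. \<phi> t) = (\<Sum>t\<in>progression w c 0 R. \<phi> t)"
    by (rule sum.reindex_bij_witness[of _ uminus uminus])
       (auto simp: progression_def neg even)
  with sum_progression_split[of "- R" 0 R w c \<phi>] assms(3,4) show ?thesis by simp
qed

section \<open>The potentials\<close>

text \<open>
  The weights of columns and rows (\<open>line_potential\<close>), of the wide classes of diagonals and of the narrow classes,
  as functions of the distance from the centre in units of \<open>W = R\<^sub>0 / 2\<close>. Neighbouring parabolas meet at the
  breakpoints: \<open>54 u\<^sup>2\<close> and \<open>14 - 18 (u - 1)\<^sup>2\<close> agree at \<open>1/3\<close> and again at \<open>1/6\<close>, while \<open>14 + 9 u\<^sup>2\<close> and
  \<open>21 - 27 (u - 1)\<^sup>2\<close> agree at \<open>5/6\<close> and again at \<open>2/3\<close>. The second intersections are what makes each parabola a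
  bound on the potential beyond its own piece.
\<close>

definition line_potential :: "real \<Rightarrow> real" where
  "line_potential u = (if \<bar>u\<bar> \<le> 1/3 then 54 * u\<^sup>2 else 14 - 18 * (\<bar>u\<bar> - 1)\<^sup>2)"

definition wide_potential :: "real \<Rightarrow> real" where
  "wide_potential u =
    (if \<bar>u\<bar> \<le> 5/6 then 14 + 9 * u\<^sup>2
     else if \<bar>u\<bar> < 7/6 then 21 - 27 * (\<bar>u\<bar> - 1)\<^sup>2
     else 14 + 9 * (\<bar>u\<bar> - 2)\<^sup>2)"

definition narrow_potential :: "real \<Rightarrow> real" where
  "narrow_potential u = max 0 (28 - 27 * u\<^sup>2)"

lemma potential_abs [simp]:
  "line_potential \<bar>u\<bar> = line_potential u" "wide_potential \<bar>u\<bar> = wide_potential u"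
  "narrow_potential \<bar>u\<bar> = narrow_potential u"
  by (simp_all add: line_potential_def wide_potential_def narrow_potential_def)

lemma line_potential_le_inner: "line_potential u \<le> 54 * u\<^sup>2"
proof (cases "\<bar>u\<bar> \<le> 1/3")
  case False
  hence "0 \<le> (3 * \<bar>u\<bar> - 1) * (6 * \<bar>u\<bar> - 1)" by (intro mult_nonneg_nonneg) auto
  hence "14 - 18 * (\<bar>u\<bar> - 1)\<^sup>2 \<le> 54 * \<bar>u\<bar>\<^sup>2"
    by (simp only: power2_eq_square ring_distribs; linarith)
  with False show ?thesis by (simp add: line_potential_def)
qed (simp add: line_potential_def)

lemma line_potential_le_outer:
  assumes "1/6 \<le> \<bar>u\<bar>"
  shows "line_potential u \<le> 14 - 18 * (\<bar>u\<bar> - 1)\<^sup>2"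
proof (cases "\<bar>u\<bar> \<le> 1/3")
  case True
  with assms have "0 \<le> (1 - 3 * \<bar>u\<bar>) * (6 * \<bar>u\<bar> - 1)" by (intro mult_nonneg_nonneg) auto
  hence "54 * \<bar>u\<bar>\<^sup>2 \<le> 14 - 18 * (\<bar>u\<bar> - 1)\<^sup>2"
    by (simp only: power2_eq_square ring_distribs; linarith)
  with True show ?thesis by (simp add: line_potential_def)
qed (simp add: line_potential_def)

lemma line_potential_le: "line_potential u \<le> 14"
proof (cases "\<bar>u\<bar> \<le> 1/3")
  case True
  hence "\<bar>u\<bar>\<^sup>2 \<le> (1/3)\<^sup>2" by (intro power_mono) auto
  hence "u\<^sup>2 \<le> 1/9" by (simp add: power2_eq_square)
  with True show ?thesis by (simp add: line_potential_def)
qed (simp add: line_potential_def)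

lemma line_potential_nonneg:
  assumes "\<bar>u\<bar> \<le> 3/2"
  shows "0 \<le> line_potential u"
proof (cases "\<bar>u\<bar> \<le> 1/3")
  case False
  hence "\<bar>\<bar>u\<bar> - 1\<bar> \<le> 2/3" using assms by linarith
  hence "\<bar>\<bar>u\<bar> - 1\<bar>\<^sup>2 \<le> (2/3)\<^sup>2" by (intro power_mono) auto
  hence "(\<bar>u\<bar> - 1)\<^sup>2 \<le> 4/9" by (simp add: power2_eq_square)
  with False show ?thesis by (simp add: line_potential_def)
qed (simp add: line_potential_def)

lemma wide_potential_le_left: "wide_potential u \<le> 14 + 9 * \<bar>u\<bar>\<^sup>2"
proof -
  consider "\<bar>u\<bar> \<le> 5/6" | "5/6 < \<bar>u\<bar>" "\<bar>u\<bar> < 7/6" | "7/6 \<le> \<bar>u\<bar>" by linarith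
  thus ?thesis
  proof cases
    case 2
    hence "0 \<le> (6 * \<bar>u\<bar> - 5) * (3 * \<bar>u\<bar> - 2)" by (intro mult_nonneg_nonneg) auto
    hence "21 - 27 * (\<bar>u\<bar> - 1)\<^sup>2 \<le> 14 + 9 * \<bar>u\<bar>\<^sup>2"
      by (simp only: power2_eq_square ring_distribs; linarith)
    with 2 show ?thesis by (simp add: wide_potential_def)
  next
    case 3
    have "(\<bar>u\<bar> - 2)\<^sup>2 \<le> \<bar>u\<bar>\<^sup>2" using 3 by (simp only: power2_eq_square ring_distribs; linarith)
    with 3 show ?thesis by (simp add: wide_potential_def)
  qed (simp add: wide_potential_def)
qed

lemma wide_potential_le_right: "wide_potential u \<le> 14 + 9 * (\<bar>u\<bar> - 2)\<^sup>2"
proof -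
  consider "\<bar>u\<bar> \<le> 5/6" | "5/6 < \<bar>u\<bar>" "\<bar>u\<bar> < 7/6" | "7/6 \<le> \<bar>u\<bar>" by linarith
  thus ?thesis
  proof cases
    case 1
    have "\<bar>u\<bar>\<^sup>2 \<le> (\<bar>u\<bar> - 2)\<^sup>2" using 1 by (simp only: power2_eq_square ring_distribs; linarith)
    with 1 show ?thesis by (simp add: wide_potential_def)
  next
    case 2
    hence "0 \<le> (7 - 6 * \<bar>u\<bar>) * (4 - 3 * \<bar>u\<bar>)" by (intro mult_nonneg_nonneg) auto
    hence "21 - 27 * (\<bar>u\<bar> - 1)\<^sup>2 \<le> 14 + 9 * (\<bar>u\<bar> - 2)\<^sup>2"
      by (simp only: power2_eq_square ring_distribs; linarith)
    with 2 show ?thesis by (simp add: wide_potential_def)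
  qed (simp add: wide_potential_def)
qed

lemma wide_potential_le_middle:
  assumes "2/3 \<le> \<bar>u\<bar>" "\<bar>u\<bar> \<le> 4/3"
  shows "wide_potential u \<le> 21 - 27 * (\<bar>u\<bar> - 1)\<^sup>2"
proof -
  consider "\<bar>u\<bar> \<le> 5/6" | "5/6 < \<bar>u\<bar>" "\<bar>u\<bar> < 7/6" | "7/6 \<le> \<bar>u\<bar>" by linarith
  thus ?thesis
  proof cases
    case 1
    with assms have "0 \<le> (5 - 6 * \<bar>u\<bar>) * (3 * \<bar>u\<bar> - 2)" by (intro mult_nonneg_nonneg) auto
    hence "14 + 9 * \<bar>u\<bar>\<^sup>2 \<le> 21 - 27 * (\<bar>u\<bar> - 1)\<^sup>2"
      by (simp only: power2_eq_square ring_distribs; linarith)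
    with 1 show ?thesis by (simp add: wide_potential_def)
  next
    case 3
    with assms have "0 \<le> (6 * \<bar>u\<bar> - 7) * (4 - 3 * \<bar>u\<bar>)" by (intro mult_nonneg_nonneg) auto
    hence "14 + 9 * (\<bar>u\<bar> - 2)\<^sup>2 \<le> 21 - 27 * (\<bar>u\<bar> - 1)\<^sup>2"
      by (simp only: power2_eq_square ring_distribs; linarith)
    with 3 show ?thesis by (simp add: wide_potential_def)
  qed (simp add: wide_potential_def)
qed

lemma wide_potential_le:
  assumes "\<bar>u\<bar> \<le> 14/5"
  shows "wide_potential u \<le> 21"
proof -
  consider "\<bar>u\<bar> \<le> 5/6" | "5/6 < \<bar>u\<bar>" "\<bar>u\<bar> < 7/6" | "7/6 \<le> \<bar>u\<bar>" by linarith
  thus ?thesis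
  proof cases
    case 1
    hence "\<bar>u\<bar>\<^sup>2 \<le> (5/6)\<^sup>2" by (intro power_mono) auto
    hence "u\<^sup>2 \<le> 25/36" by (simp add: power2_eq_square)
    with 1 show ?thesis by (simp add: wide_potential_def)
  next
    case 3
    hence "\<bar>\<bar>u\<bar> - 2\<bar> \<le> 5/6" using assms by linarith
    hence "\<bar>\<bar>u\<bar> - 2\<bar>\<^sup>2 \<le> (5/6)\<^sup>2" by (intro power_mono) auto
    hence "(\<bar>u\<bar> - 2)\<^sup>2 \<le> 25/36" by (simp add: power2_eq_square)
    with 3 show ?thesis by (simp add: wide_potential_def)
  qed (simp add: wide_potential_def)
qed

lemma wide_potential_nonneg: "0 \<le> wide_potential u"
proof -
  have "27 * (\<bar>u\<bar> - 1)\<^sup>2 \<le> 21" if "5/6 < \<bar>u\<bar>" "\<bar>u\<bar> < 7/6"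
  proof -
    have "\<bar>\<bar>u\<bar> - 1\<bar> \<le> 1/6" using that by linarith
    hence "\<bar>\<bar>u\<bar> - 1\<bar>\<^sup>2 \<le> (1/6)\<^sup>2" by (intro power_mono) auto
    thus ?thesis by (simp add: power2_eq_square)
  qed
  thus ?thesis by (auto simp: wide_potential_def)
qed

lemma narrow_potential_nonneg: "0 \<le> narrow_potential u"
  and narrow_potential_le: "narrow_potential u \<le> 28"
  by (simp_all add: narrow_potential_def)

text \<open>
  Here \<open>U\<close> and \<open>L\<close> are the larger and the smaller distance of a square from the axes, so that \<open>p = U + L\<close> and
  \<open>q = U - L\<close> are the larger and the smaller of \<open>\<bar>y - x\<bar>\<close> and \<open>\<bar>x + y\<bar>\<close>. Away from the axes the outer parabolas balance:
  \<open>q\<^sup>2 + (p - 2)\<^sup>2 = 2 (U - 1)\<^sup>2 + 2 (L - 1)\<^sup>2\<close>. Near an axis, where \<open>p\<close> and \<open>q\<close> are close to each other, the middle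
  parabola of the diagonals balances the inner parabola at \<open>L\<close>: \<open>(p - 1)\<^sup>2 + (q - 1)\<^sup>2 = 2 (U - 1)\<^sup>2 + 2 L\<^sup>2\<close>.
\<close>

lemma wide_potential_balance_octant:
  fixes L U :: real
  assumes "0 \<le> L" "L \<le> U"
  shows "wide_potential (U - L) + wide_potential (U + L) + line_potential U + line_potential L \<le> 56"
proof -
  define q p where "q = U - L" and "p = U + L"
  have pq: "0 \<le> q" "q \<le> p" using assms by (simp_all add: p_def q_def)
  have abs [simp]: "\<bar>U\<bar> = U" "\<bar>L\<bar> = L" "\<bar>p\<bar> = p" "\<bar>q\<bar> = q" using assms pq by simp_all
  note left = wide_potential_le_left[of q] wide_potential_le_left[of p]
  note right = wide_potential_le_right[of q] wide_potential_le_right[of p]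
  have "wide_potential q + wide_potential p + line_potential U + line_potential L \<le> 56"
  proof (cases "1/6 \<le> L")
    case True
    have "9 * (q\<^sup>2 + (p - 2)\<^sup>2) = 18 * ((U - 1)\<^sup>2 + (L - 1)\<^sup>2)"
      by (simp add: p_def q_def power2_eq_square algebra_simps)
    with True assms left(1) right(2) line_potential_le_outer[of U] line_potential_le_outer[of L]
    show ?thesis by simp
  next
    case False
    have L: "line_potential L \<le> 54 * L\<^sup>2" by (rule line_potential_le_inner)
    \<comment> \<open>equality at \<open>L = 1/6\<close>: exactly what is needed once \<open>q < 2/3\<close> or \<open>p > 4/3\<close>\<close>
    have small: "72 * L\<^sup>2 + 36 * L \<le> 8"
    proof -
      have "L * L \<le> 1/6 * (1/6)" using False assms by (intro mult_mono) auto
      with False show ?thesis by (simp add: power2_eq_square)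
    qed
    consider "U < 1/6" | "1/6 \<le> U" "2/3 \<le> q" "p \<le> 4/3" | "1/6 \<le> U" "q < 2/3" | "4/3 < p"
      by linarith
    thus ?thesis
    proof cases
      case 1
      have "U * U \<le> 1/6 * (1/6)" using 1 assms by (intro mult_mono) auto
      moreover have "L * L \<le> 1/6 * (1/6)" using 1 assms by (intro mult_mono) auto
      moreover have "q\<^sup>2 + p\<^sup>2 = 2 * (U * U) + 2 * (L * L)"
        by (simp add: p_def q_def power2_eq_square algebra_simps)
      ultimately show ?thesis using left L line_potential_le_inner[of U]
        by (simp add: power2_eq_square)
    next
      case 2
      have "wide_potential q \<le> 21 - 27 * (q - 1)\<^sup>2" "wide_potential p \<le> 21 - 27 * (p - 1)\<^sup>2"
        using wide_potential_le_middle[of q] wide_potential_le_middle[of p] 2 pq by simp_all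
      moreover have "(q - 1)\<^sup>2 + (p - 1)\<^sup>2 = 2 * (U - 1)\<^sup>2 + 2 * L\<^sup>2"
        by (simp add: p_def q_def power2_eq_square algebra_simps)
      moreover have "line_potential U \<le> 14 - 18 * (U - 1)\<^sup>2"
        using line_potential_le_outer[of U] 2 by simp
      moreover have "0 \<le> (U - 1)\<^sup>2" by simp
      ultimately show ?thesis using L by linarith
    next
      case 3
      have "q\<^sup>2 + p\<^sup>2 = 2 * U\<^sup>2 + 2 * L\<^sup>2" "(U - 1)\<^sup>2 = U\<^sup>2 - 2 * U + 1"
        by (simp_all add: p_def q_def power2_eq_square algebra_simps)
      moreover have "line_potential U \<le> 14 - 18 * (U - 1)\<^sup>2"
        using line_potential_le_outer[of U] 3 by simp
      moreover have "U < 2/3 + L" using 3 by (simp add: q_def)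
      ultimately show ?thesis using L left small by simp
    next
      case 4
      have "(q - 2)\<^sup>2 + (p - 2)\<^sup>2 = 2 * (U - 2)\<^sup>2 + 2 * L\<^sup>2" "(U - 1)\<^sup>2 = U\<^sup>2 - 2 * U + 1"
        "(U - 2)\<^sup>2 = U\<^sup>2 - 4 * U + 4"
        by (simp_all add: p_def q_def power2_eq_square algebra_simps)
      moreover have U: "4/3 - L < U" using 4 by (simp add: p_def)
      moreover have "line_potential U \<le> 14 - 18 * (U - 1)\<^sup>2"
        using line_potential_le_outer[of U] U False by simp
      ultimately show ?thesis using L right small by simp
    qed
  qed
  thus ?thesis by (simp add: p_def q_def)
qed

lemma wide_potential_balance:
  "wide_potential (y - x) + wide_potential (x + y) + line_potential x + line_potential y \<le> 56"
proof -
  define U L where "U = max \<bar>x\<bar> \<bar>y\<bar>" and "L = min \<bar>x\<bar> \<bar>y\<bar>"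
  have "wide_potential (U - L) + wide_potential (U + L) + line_potential U + line_potential L \<le> 56"
    by (rule wide_potential_balance_octant) (auto simp: U_def L_def)
  moreover have "line_potential U + line_potential L = line_potential x + line_potential y"
    by (auto simp: U_def L_def max_def min_def)
  moreover have "\<bar>y - x\<bar> = U - L \<and> \<bar>x + y\<bar> = U + L \<or> \<bar>y - x\<bar> = U + L \<and> \<bar>x + y\<bar> = U - L"
    unfolding U_def L_def by linarith
  hence "wide_potential (U - L) + wide_potential (U + L) = wide_potential (y - x) + wide_potential (x + y)"
    by (metis potential_abs(2) add.commute)
  ultimately show ?thesis by linarith
qed

text \<open>
  While both diagonals carry a positive weight, the inner parabola balances them by the parallelogram law.
  Otherwise one diagonal weighs nothing and the crude bounds \<open>28 + 14 + 14\<close> suffice.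
\<close>

lemma narrow_potential_balance:
  "narrow_potential (y - x) + narrow_potential (x + y) + line_potential x + line_potential y \<le> 56"
proof (cases "28 - 27 * (y - x)\<^sup>2 \<le> 0 \<or> 28 - 27 * (x + y)\<^sup>2 \<le> 0")
  case True
  hence "narrow_potential (y - x) + narrow_potential (x + y) \<le> 28"
    by (auto simp: narrow_potential_def)
  with line_potential_le[of x] line_potential_le[of y] show ?thesis by linarith
next
  case False
  have "27 * ((y - x)\<^sup>2 + (x + y)\<^sup>2) = 54 * (x\<^sup>2 + y\<^sup>2)"
    by (simp add: power2_eq_square algebra_simps)
  with False line_potential_le_inner[of x] line_potential_le_inner[of y] show ?thesis
    by (simp add: narrow_potential_def)
qed

section \<open>Occupied diagonals of a cover\<close>

definition difference :: "square \<Rightarrow> int" where "difference q = snd q - fst q"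

definition total :: "square \<Rightarrow> int" where "total q = fst q + snd q"

text \<open>
  Each occupied line of \<open>T\<close> is charged to one of its queens, and nonnegativity makes the other queens harmless.
\<close>

lemma sum_le_sum_occupied:
  fixes w :: "'b \<Rightarrow> real" and f :: "'a \<Rightarrow> 'b" and m M :: real
  assumes "finite C" "finite T"
    and nonneg: "\<And>q. q \<in> C \<Longrightarrow> 0 \<le> w (f q)"
    and le: "\<And>t. t \<in> T \<Longrightarrow> w t \<le> M" and "0 \<le> M"
    and missing: "real (card (T - f ` C)) \<le> m"
  shows "(\<Sum>t\<in>T. w t) \<le> (\<Sum>q\<in>C. w (f q)) + m * M"
proof -
  have "(\<Sum>t\<in>T. w t) = (\<Sum>t\<in>T \<inter> f ` C. w t) + (\<Sum>t\<in>T - f ` C. w t)"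
    using assms(2) by (subst sum.union_disjoint[symmetric]) (auto intro!: sum.cong)
  also have "(\<Sum>t\<in>T \<inter> f ` C. w t) \<le> (\<Sum>t\<in>f ` C. w t)"
    by (rule sum_mono2) (use assms in auto)
  also have "(\<Sum>t\<in>f ` C. w t) \<le> (\<Sum>q\<in>C. w (f q))"
    using sum_image_le[of C w f] assms by (simp add: o_def)
  also have "(\<Sum>t\<in>T - f ` C. w t) \<le> real (card (T - f ` C)) * M"
    using sum_bounded_above[of "T - f ` C" w M] le by auto
  also have "\<dots> \<le> m * M" using missing \<open>0 \<le> M\<close> by (rule mult_right_mono)
  finally show ?thesis by simp
qed

text \<open>
  Modulo 4, a square with even \<open>d = y - x\<close> belongs to one class of differences and one class of sums, tied
  together by \<open>d + s = 2 y\<close>. Class \<open>c\<close> of differences goes with class \<open>2 e - c\<close> of sums on squares whose coordinates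
  have parity \<open>e\<close>, and with the other even class on squares whose coordinates have the other parity. The last
  alternative consists of the squares with odd \<open>d\<close>.
\<close>

lemma square_types:
  fixes c e x y :: int
  assumes "c \<in> {0, 2}" "e \<in> {0, 1}"
  shows "(x mod 2 = e \<and> (y - x) mod 4 = c \<and> (x + y) mod 4 = (2 * e - c) mod 4)
    \<or> (x mod 2 = e \<and> (y - x) mod 4 = (c + 2) mod 4 \<and> (x + y) mod 4 = (2 * e + 2 - c) mod 4)
    \<or> (x mod 2 \<noteq> e \<and> (y - x) mod 4 = c \<and> (x + y) mod 4 = (2 * e + 2 - c) mod 4)
    \<or> (x mod 2 \<noteq> e \<and> (y - x) mod 4 = (c + 2) mod 4 \<and> (x + y) mod 4 = (2 * e - c) mod 4)
    \<or> ((y - x) mod 4 \<noteq> c \<and> (y - x) mod 4 \<noteq> (c + 2) mod 4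
       \<and> (x + y) mod 4 \<noteq> (2 * e - c) mod 4 \<and> (x + y) mod 4 \<noteq> (2 * e + 2 - c) mod 4)"
proof -
  define i j where "i = x mod 4" and "j = y mod 4"
  have reduce: "(y - x) mod 4 = (j - i) mod 4" "(x + y) mod 4 = (i + j) mod 4" "x mod 2 = i mod 2"
    by (simp_all add: i_def j_def mod_simps mod_mod_cancel)
  have "0 \<le> i" "i < 4" "0 \<le> j" "j < 4" by (simp_all add: i_def j_def)
  hence "i \<in> {0, 1, 2, 3}" "j \<in> {0, 1, 2, 3}" by auto
  with assms show ?thesis unfolding reduce by - (elim insertE emptyE; simp)
qed

text \<open>
  A relaxed cover of the board with coordinates from \<open>-h\<close> to \<open>h\<close>, in which \<open>e\<close> is the parity of the lines that
  must be occupied and domination is expressed through occupied lines.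
\<close>

locale centred_cover =
  fixes h e :: int and C :: "square set"
  assumes h_pos: "0 < h" and e: "e \<in> {0, 1}"
    and finite_queens: "finite C"
    and board: "\<And>x y. (x, y) \<in> C \<Longrightarrow> \<bar>x\<bar> \<le> h \<and> \<bar>y\<bar> \<le> h"
    and columns: "\<And>x. \<lbrakk>\<bar>x\<bar> \<le> h; x mod 2 = e\<rbrakk> \<Longrightarrow> x \<in> fst ` C"
    and rows: "\<And>y. \<lbrakk>\<bar>y\<bar> \<le> h; y mod 2 = e\<rbrakk> \<Longrightarrow> y \<in> snd ` C"
    and dominated: "\<And>x y. \<lbrakk>\<bar>x\<bar> \<le> h; \<bar>y\<bar> \<le> h\<rbrakk> \<Longrightarrow>
      x \<in> fst ` C \<or> y \<in> snd ` C \<or> y - x \<in> difference ` C \<or> x + y \<in> total ` C"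
begin

definition excess :: int where "excess = int (card C) - h"

lemma card_wrong_parity:
  fixes f :: "square \<Rightarrow> int"
  assumes "\<And>x. \<lbrakk>\<bar>x\<bar> \<le> h; x mod 2 = e\<rbrakk> \<Longrightarrow> x \<in> f ` C"
  shows "int (card {q\<in>C. f q mod 2 \<noteq> e}) \<le> excess"
proof -
  \<comment> \<open>the open interval of length \<open>2 h + 2\<close> gives \<open>h\<close> lines, one more than that of length \<open>2 h\<close>\<close>
  have "real_of_int (h + 1) - real_of_int (- h - 1) - 2
      \<le> 2 * real (card (progression 2 e (- h - 1) (h + 1)))"
    using card_progression_ge[of 2 e "real_of_int (h + 1)" "real_of_int (- h - 1)"] e by auto
  hence "h \<le> int (card (progression 2 e (- h - 1) (h + 1)))" by simp
  also have "card (progression 2 e (- h - 1) (h + 1)) \<le> card (f ` {q\<in>C. f q mod 2 = e})"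
  proof (rule card_mono)
    show "progression 2 e (- h - 1) (h + 1) \<subseteq> f ` {q\<in>C. f q mod 2 = e}"
    proof
      fix x assume "x \<in> progression 2 e (- h - 1) (h + 1)"
      hence "x mod 2 = e" "\<bar>x\<bar> \<le> h" by (auto simp: progression_def)
      with assms[of x] show "x \<in> f ` {q\<in>C. f q mod 2 = e}" by auto
    qed
  qed (use finite_queens in auto)
  also have "\<dots> \<le> card {q\<in>C. f q mod 2 = e}"
    by (rule card_image_le) (use finite_queens in auto)
  finally have 1: "h \<le> int (card {q\<in>C. f q mod 2 = e})" by simp
  have "card C = card ({q\<in>C. f q mod 2 = e} \<union> {q\<in>C. f q mod 2 \<noteq> e})"
    by (rule arg_cong[of _ _ card]) auto
  also have "\<dots> = card {q\<in>C. f q mod 2 = e} + card {q\<in>C. f q mod 2 \<noteq> e}"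
    by (rule card_Un_disjoint) (use finite_queens in auto)
  finally show ?thesis using 1 by (simp add: excess_def)
qed

lemma excess_nonneg: "0 \<le> excess"
  using card_wrong_parity[OF columns] by linarith

lemma card_wrong_image:
  fixes f :: "square \<Rightarrow> int"
  assumes "\<And>x. \<lbrakk>\<bar>x\<bar> \<le> h; x mod 2 = e\<rbrakk> \<Longrightarrow> x \<in> f ` C"
  shows "int (card {x \<in> f ` C. x mod 2 \<noteq> e}) \<le> excess"
proof -
  have "{x \<in> f ` C. x mod 2 \<noteq> e} = f ` {q\<in>C. f q mod 2 \<noteq> e}" by auto
  hence "card {x \<in> f ` C. x mod 2 \<noteq> e} \<le> card {q\<in>C. f q mod 2 \<noteq> e}"
    using card_image_le[of "{q\<in>C. f q mod 2 \<noteq> e}" f] finite_queens by simp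
  with card_wrong_parity[OF assms] show ?thesis by linarith
qed

lemma difference_bound: "q \<in> C \<Longrightarrow> \<bar>difference q\<bar> \<le> 2 * h"
  and total_bound: "q \<in> C \<Longrightarrow> \<bar>total q\<bar> \<le> 2 * h"
  using board[of "fst q" "snd q"] by (auto simp: difference_def total_def)

text \<open>
  \<open>A\<close> is the distance from the centre of the nearest empty difference diagonal \<open>d\<close> of class \<open>c\<close>. A square with wrong
  parities on \<open>d\<close> whose sum diagonal is empty too must be covered by its column or row. There are at most \<open>excess\<close>
  occupied columns of the wrong parity and each meets \<open>d\<close> once; the same holds for rows.
\<close>

lemma occupied_core:
  assumes c: "c \<in> {0, 2}"
  obtains A where "0 \<le> A" "A \<le> 2 * h"
    and "progression 4 c (- real_of_int A) A \<subseteq> difference ` C"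
    and "int (card (progression 4 ((2 * e + 2 - c) mod 4) (- real_of_int (2 * h - A)) (2 * h - A) - total ` C)) \<le> 2 * excess"
proof -
  define Q where "Q = {d. \<bar>d\<bar> \<le> 2 * h \<and> d mod 4 = c \<and> d \<notin> difference ` C}"
  have finQ: "finite Q"
    by (rule finite_subset[of _ "{- 2 * h..2 * h}"]) (auto simp: Q_def)
  show thesis
  proof (cases "Q = {}")
    case True
    have 1: "progression 4 c (- (2 * h)) (2 * h) \<subseteq> difference ` C"
    proof
      fix d assume "d \<in> progression 4 c (- (2 * h)) (2 * h)"
      hence "\<bar>d\<bar> \<le> 2 * h" "d mod 4 = c" by (auto simp: progression_def)
      with True show "d \<in> difference ` C" by (auto simp: Q_def)
    qed
    have 2: "progression 4 ((2 * e + 2 - c) mod 4) (- (2 * h - 2 * h)) (2 * h - 2 * h) = {}"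
      by (auto simp: progression_def)
    \<comment> \<open>every diagonal of the class is occupied, and nothing is required of the sums\<close>
    show thesis by (rule that[of "2 * h"]) (use h_pos excess_nonneg 1 2 in auto)
  next
    case False
    define A where "A = Min (abs ` Q)"
    have "A \<in> abs ` Q" unfolding A_def by (rule Min_in) (use finQ False in auto)
    then obtain d where d: "d \<in> Q" "A = \<bar>d\<bar>" by auto
    have dd: "\<bar>d\<bar> \<le> 2 * h" "d mod 4 = c" "d \<notin> difference ` C" using d by (auto simp: Q_def)
    have 1: "progression 4 c (- real_of_int A) A \<subseteq> difference ` C"
    proof
      fix t assume "t \<in> progression 4 c (- real_of_int A) A"
      hence t: "\<bar>t\<bar> < A" "t mod 4 = c" by (auto simp: progression_def)
      have "t \<notin> Q"
      proof
        assume "t \<in> Q"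
        hence "A \<le> \<bar>t\<bar>" unfolding A_def by (intro Min_le) (use finQ in auto)
        with t show False by simp
      qed
      with t d dd show "t \<in> difference ` C" by (auto simp: Q_def)
    qed
    let ?S = "progression 4 ((2 * e + 2 - c) mod 4) (- real_of_int (2 * h - A)) (2 * h - A) - total ` C"
    let ?X = "{x \<in> fst ` C. x mod 2 \<noteq> e}" and ?Y = "{y \<in> snd ` C. y mod 2 \<noteq> e}"
    have "?S \<subseteq> (\<lambda>x. 2 * x + d) ` ?X \<union> (\<lambda>y. 2 * y - d) ` ?Y"
    proof
      fix s assume "s \<in> ?S"
      hence s: "\<bar>s\<bar> < 2 * h - A" "s mod 4 = (2 * e + 2 - c) mod 4" "s \<notin> total ` C"
        by (auto simp: progression_def)
      define x where "x = (s - d) div 2"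
      define y where "y = x + d"
      have ce: "c = 0 \<or> c = 2" "e = 0 \<or> e = 1" using c e by auto
      have sx: "s = 2 * x + d" and xe: "x mod 2 \<noteq> e" and ye: "y mod 2 \<noteq> e"
        using s(2) dd(2) ce unfolding x_def y_def
        by - (elim disjE; simp; presburger)+
      have "2 * x = s - d" "2 * y = s + d" using sx by (auto simp: y_def)
      hence "\<bar>x\<bar> \<le> h" "\<bar>y\<bar> \<le> h" using s(1) d(2) by linarith+
      hence "x \<in> fst ` C \<or> y \<in> snd ` C \<or> y - x \<in> difference ` C \<or> x + y \<in> total ` C"
        by (rule dominated)
      moreover have "y - x = d" "x + y = s" using sx by (auto simp: y_def)
      ultimately have "x \<in> ?X \<or> y \<in> ?Y" using dd(3) s(3) xe ye by auto
      moreover have "s = 2 * y - d" using sx by (simp add: y_def)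
      ultimately show "s \<in> (\<lambda>x. 2 * x + d) ` ?X \<union> (\<lambda>y. 2 * y - d) ` ?Y"
        using sx by blast
    qed
    hence "card ?S \<le> card ((\<lambda>x. 2 * x + d) ` ?X \<union> (\<lambda>y. 2 * y - d) ` ?Y)"
      by (rule card_mono[rotated]) (use finite_queens in auto)
    also have "\<dots> \<le> card ((\<lambda>x. 2 * x + d) ` ?X) + card ((\<lambda>y. 2 * y - d) ` ?Y)"
      by (rule card_Un_le)
    also have "\<dots> \<le> card ?X + card ?Y"
      by (intro add_mono card_image_le) (use finite_queens in auto)
    finally have "int (card ?S) \<le> 2 * excess"
      using card_wrong_image[OF columns] card_wrong_image[OF rows] by linarith
    then show thesis using 1 d dd by (intro that[of A]) auto
  qed
qed

lemma card_symmetric_progression_ge: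
  assumes "0 \<le> c" "c < 4"
  shows "A - 2 \<le> 2 * int (card (progression 4 c (- real_of_int A) (real_of_int A)))"
  using card_progression_ge[of 4 c "real_of_int A" "- real_of_int A"] assms by simp

text \<open>
  Let \<open>A\<close> and \<open>B\<close> be the distances that \<open>occupied_core\<close> gives for the two classes of differences. The occupied
  differences number about \<open>(A + B) / 2\<close> and the occupied sums about \<open>(4 h - A - B) / 2\<close>. Neither exceeds the number
  of queens, which is about \<open>h\<close>; hence \<open>A + B\<close> is close to \<open>2 h\<close>. The partner of the class of radius \<open>A\<close> among the
  sums of queens of the right parity is guaranteed up to \<open>2 h - B\<close>, so the smaller of \<open>A\<close> and \<open>2 h - B\<close> serves as a
  common radius. The class with the larger radius is called \<open>c\<close>.
\<close>

lemma occupied_radii: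
  obtains c R\<^sub>0 R\<^sub>2 :: int where "c \<in> {0, 2}" "0 \<le> R\<^sub>2" "R\<^sub>2 \<le> R\<^sub>0"
    and "2 * h - 10 * excess - 4 \<le> R\<^sub>0 + R\<^sub>2" "R\<^sub>0 + R\<^sub>2 \<le> 2 * h"
    and "progression 4 c (- real_of_int R\<^sub>0) R\<^sub>0 \<subseteq> difference ` C"
    and "progression 4 ((c + 2) mod 4) (- real_of_int R\<^sub>2) R\<^sub>2 \<subseteq> difference ` C"
    and "int (card (progression 4 ((2 * e - c) mod 4) (- real_of_int R\<^sub>0) R\<^sub>0 - total ` C)) \<le> 2 * excess"
    and "int (card (progression 4 ((2 * e + 2 - c) mod 4) (- real_of_int R\<^sub>2) R\<^sub>2 - total ` C)) \<le> 2 * excess"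
proof -
  have mono: "progression 4 a (- real_of_int r) r \<subseteq> progression 4 a (- real_of_int s) s"
    if "r \<le> s" for a r s :: int
    using that by (auto simp: progression_def)
  obtain A where A: "0 \<le> A" "A \<le> 2 * h"
    and AD: "progression 4 0 (- real_of_int A) A \<subseteq> difference ` C"
    and AS: "int (card (progression 4 ((2 * e + 2 - 0) mod 4) (- real_of_int (2 * h - A)) (2 * h - A) - total ` C)) \<le> 2 * excess"
    by (rule occupied_core[of 0]) auto
  obtain B where B: "0 \<le> B" "B \<le> 2 * h"
    and BD: "progression 4 2 (- real_of_int B) B \<subseteq> difference ` C"
    and BS: "int (card (progression 4 ((2 * e + 2 - 2) mod 4) (- real_of_int (2 * h - B)) (2 * h - B) - total ` C)) \<le> 2 * excess"
    by (rule occupied_core[of 2]) auto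
  define a b where "a = (2 * e + 2 - 0) mod 4" and "b = (2 * e + 2 - 2) mod 4"
  have ab: "a \<noteq> b" "0 \<le> a" "a < 4" "0 \<le> b" "b < 4" using e by (auto simp: a_def b_def)
  note AS = AS[folded a_def] and BS = BS[folded b_def]
  have le: "A + B \<le> 2 * h + 2 * excess + 4"
  proof -
    have "card (progression 4 0 (- real_of_int A) A) + card (progression 4 2 (- real_of_int B) B)
        = card (progression 4 0 (- real_of_int A) A \<union> progression 4 2 (- real_of_int B) B)"
      by (rule card_Un_disjoint[symmetric]) (simp, simp, auto simp: progression_def)
    also have "\<dots> \<le> card (difference ` C)" by (rule card_mono) (use AD BD finite_queens in auto)
    also have "\<dots> \<le> card C" by (rule card_image_le[OF finite_queens])
    finally show ?thesis
      using card_symmetric_progression_ge[of 0 A] card_symmetric_progression_ge[of 2 B]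
      unfolding excess_def by simp
  qed
  have ge: "2 * h - 10 * excess - 4 \<le> A + B"
  proof -
    let ?P = "progression 4 a (- real_of_int (2 * h - A)) (2 * h - A)"
    let ?R = "progression 4 b (- real_of_int (2 * h - B)) (2 * h - B)"
    have "card (?P \<inter> total ` C) + card (?R \<inter> total ` C)
        = card ((?P \<inter> total ` C) \<union> (?R \<inter> total ` C))"
    proof (rule card_Un_disjoint[symmetric])
      show "(?P \<inter> total ` C) \<inter> (?R \<inter> total ` C) = {}" using ab(1) by (auto simp: progression_def)
    qed auto
    also have "\<dots> \<le> card (total ` C)" by (rule card_mono) (use finite_queens in auto)
    also have "\<dots> \<le> card C" by (rule card_image_le[OF finite_queens])
    finally have 1: "int (card (?P \<inter> total ` C)) + int (card (?R \<inter> total ` C)) \<le> h + excess"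
      by (simp add: excess_def)
    have 2: "int (card ?P) = int (card (?P \<inter> total ` C)) + int (card (?P - total ` C))"
      "int (card ?R) = int (card (?R \<inter> total ` C)) + int (card (?R - total ` C))"
      by (subst card_Int_Diff[of _ "total ` C"], simp, simp only: of_nat_add)+
    have 3: "2 * h - A - 2 \<le> 2 * int (card ?P)" "2 * h - B - 2 \<le> 2 * int (card ?R)"
      by (rule card_symmetric_progression_ge[OF ab(2,3)] card_symmetric_progression_ge[OF ab(4,5)])+
    have arith: "2 * h - 10 * k - 4 \<le> A + B"
      if "p\<^sub>1 + r\<^sub>1 \<le> h + k" "p = p\<^sub>1 + p\<^sub>2" "r = r\<^sub>1 + r\<^sub>2" "2 * h - A - 2 \<le> 2 * p" "2 * h - B - 2 \<le> 2 * r"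
        "p\<^sub>2 \<le> 2 * k" "r\<^sub>2 \<le> 2 * k" for p r p\<^sub>1 p\<^sub>2 r\<^sub>1 r\<^sub>2 k :: int
      using that by linarith
    show ?thesis by (rule arith[OF 1 2 3 AS BS])
  qed
  have smaller: "int (card (progression 4 a (- real_of_int r) r - total ` C)) \<le> 2 * excess"
    if "int (card (progression 4 a (- real_of_int s) s - total ` C)) \<le> 2 * excess" "r \<le> s"
    for a r s :: int
  proof -
    have "card (progression 4 a (- real_of_int r) r - total ` C) \<le> card (progression 4 a (- real_of_int s) s - total ` C)"
      by (rule card_mono) (use mono[OF that(2)] in auto)
    with that(1) show ?thesis by linarith
  qed
  define r where "r = min A (2 * h - B)"
  define s where "s = min B (2 * h - A)"
  have rs: "r \<le> A" "r \<le> 2 * h - B" "s \<le> B" "s \<le> 2 * h - A" by (auto simp: r_def s_def)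
  have r: "progression 4 0 (- real_of_int r) r \<subseteq> difference ` C"
    using mono[OF rs(1)] AD by (rule subset_trans)
  have s: "progression 4 2 (- real_of_int s) s \<subseteq> difference ` C"
    using mono[OF rs(3)] BD by (rule subset_trans)
  note r' = smaller[OF BS rs(2)] and s' = smaller[OF AS rs(4)]
  have sum: "2 * h - 10 * excess - 4 \<le> r + s" "r + s \<le> 2 * h" "0 \<le> r" "0 \<le> s"
    using A B le ge excess_nonneg unfolding r_def s_def by linarith+
  show thesis
  proof (cases "B \<le> A")
    case True
    hence "s \<le> r" unfolding r_def s_def by linarith
    moreover have "(2 * e - 0) mod 4 = b" "(2 * e + 2 - 0) mod 4 = a" "(0 + 2) mod 4 = (2::int)"
      by (simp_all add: a_def b_def)
    ultimately show thesis
      using r s r' s' sum by (intro that[of 0 s r]) (simp_all only: insertI1 add.commute)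
  next
    case False
    hence "r \<le> s" unfolding r_def s_def by linarith
    moreover have "(2 * e - 2) mod 4 = a" "(2 * e + 2 - 2) mod 4 = b" "(2 + 2) mod 4 = (0::int)"
      unfolding a_def b_def by presburger+
    ultimately show thesis
      using r s r' s' sum by (intro that[of 2 r s]) (simp_all only: insertI1 insertI2 add.commute)
  qed
qed

section \<open>Weighted counting of lines\<close>

text \<open>
  Weak duality. Queens with both coordinates of parity \<open>e\<close> weigh at most \<open>\<kappa>\<close> by the hypotheses \<open>right\<close>. Those on a
  square with odd \<open>y - x\<close> are charged for their column and row only. Those with both coordinates of the wrong
  parity combine a wide with a narrow class; they may cost \<open>\<nu>\<close> more, but there are at most \<open>excess\<close> of them. The
  term \<open>4 * excess * M\<close> pays for the sum diagonals that \<open>occupied_radii\<close> leaves empty.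
\<close>

lemma weighted_count:
  fixes w\<^sub>x a\<^sub>0 a\<^sub>2 :: "int \<Rightarrow> real" and \<kappa> \<nu> M :: real and c R\<^sub>0 R\<^sub>2 :: int
  assumes c: "c \<in> {0, 2}" and "0 \<le> R\<^sub>2" "R\<^sub>2 \<le> R\<^sub>0" "R\<^sub>0 \<le> 2 * h"
    and D: "progression 4 c (- real_of_int R\<^sub>0) R\<^sub>0 \<subseteq> difference ` C"
      "progression 4 ((c + 2) mod 4) (- real_of_int R\<^sub>2) R\<^sub>2 \<subseteq> difference ` C"
    and S: "int (card (progression 4 ((2 * e - c) mod 4) (- real_of_int R\<^sub>0) R\<^sub>0 - total ` C)) \<le> 2 * excess"
      "int (card (progression 4 ((2 * e + 2 - c) mod 4) (- real_of_int R\<^sub>2) R\<^sub>2 - total ` C)) \<le> 2 * excess"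
    and x_nonneg: "\<And>t. \<bar>t\<bar> \<le> h \<Longrightarrow> 0 \<le> w\<^sub>x t"
    and nonneg: "\<And>t. \<bar>t\<bar> \<le> 2 * h \<Longrightarrow> 0 \<le> a\<^sub>0 t" "\<And>t. \<bar>t\<bar> \<le> 2 * h \<Longrightarrow> 0 \<le> a\<^sub>2 t"
    and le: "\<And>t. \<bar>t\<bar> \<le> 2 * h \<Longrightarrow> a\<^sub>0 t \<le> M" "\<And>t. \<bar>t\<bar> \<le> 2 * h \<Longrightarrow> a\<^sub>2 t \<le> M"
    and right: "\<And>x y. \<lbrakk>\<bar>x\<bar> \<le> h; \<bar>y\<bar> \<le> h\<rbrakk> \<Longrightarrow> a\<^sub>0 (y - x) + a\<^sub>0 (x + y) + w\<^sub>x x + w\<^sub>x y \<le> \<kappa>"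
      "\<And>x y. \<lbrakk>\<bar>x\<bar> \<le> h; \<bar>y\<bar> \<le> h\<rbrakk> \<Longrightarrow> a\<^sub>2 (y - x) + a\<^sub>2 (x + y) + w\<^sub>x x + w\<^sub>x y \<le> \<kappa>"
    and wrong: "\<And>x y. \<lbrakk>\<bar>x\<bar> \<le> h; \<bar>y\<bar> \<le> h\<rbrakk> \<Longrightarrow> a\<^sub>0 (y - x) + a\<^sub>2 (x + y) + w\<^sub>x x + w\<^sub>x y \<le> \<kappa> + \<nu>"
      "\<And>x y. \<lbrakk>\<bar>x\<bar> \<le> h; \<bar>y\<bar> \<le> h\<rbrakk> \<Longrightarrow> a\<^sub>2 (y - x) + a\<^sub>0 (x + y) + w\<^sub>x x + w\<^sub>x y \<le> \<kappa> + \<nu>"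
    and "0 \<le> \<nu>"
  shows "2 * (\<Sum>t\<in>progression 2 e (- real_of_int h) h. w\<^sub>x t)
      + (\<Sum>t\<in>progression 4 c (- real_of_int R\<^sub>0) R\<^sub>0. a\<^sub>0 t) + (\<Sum>t\<in>progression 4 ((c + 2) mod 4) (- real_of_int R\<^sub>2) R\<^sub>2. a\<^sub>2 t)
      + (\<Sum>t\<in>progression 4 ((2 * e - c) mod 4) (- real_of_int R\<^sub>0) R\<^sub>0. a\<^sub>0 t)
      + (\<Sum>t\<in>progression 4 ((2 * e + 2 - c) mod 4) (- real_of_int R\<^sub>2) R\<^sub>2. a\<^sub>2 t)
      \<le> \<kappa> * real_of_int (h + excess) + \<nu> * real_of_int excess + 4 * real_of_int excess * M"
proof -
  let ?D\<^sub>0 = "progression 4 c (- real_of_int R\<^sub>0) R\<^sub>0" and ?D\<^sub>2 = "progression 4 ((c + 2) mod 4) (- real_of_int R\<^sub>2) R\<^sub>2"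
  let ?S\<^sub>0 = "progression 4 ((2 * e - c) mod 4) (- real_of_int R\<^sub>0) R\<^sub>0"
  let ?S\<^sub>2 = "progression 4 ((2 * e + 2 - c) mod 4) (- real_of_int R\<^sub>2) R\<^sub>2"
  define w\<^sub>d where "w\<^sub>d t = (if t mod 4 = c then a\<^sub>0 t else if t mod 4 = (c + 2) mod 4 then a\<^sub>2 t else 0)" for t
  define w\<^sub>s where "w\<^sub>s t = (if t mod 4 = (2 * e - c) mod 4 then a\<^sub>0 t
      else if t mod 4 = (2 * e + 2 - c) mod 4 then a\<^sub>2 t else 0)" for t
  have M: "0 \<le> M" using nonneg(1)[of 0] le(1)[of 0] h_pos by simp
  have ce: "c = 0 \<or> c = 2" "e = 0 \<or> e = 1" using c e by auto
  have distinct: "(c + 2) mod 4 \<noteq> c" "(2 * e + 2 - c) mod 4 \<noteq> (2 * e - c) mod 4"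
    using ce by auto
  have line: "(\<Sum>t\<in>progression 2 e (- real_of_int h) h. w\<^sub>x t) \<le> (\<Sum>q\<in>C. w\<^sub>x (f q))"
    if f: "\<And>x. \<lbrakk>\<bar>x\<bar> \<le> h; x mod 2 = e\<rbrakk> \<Longrightarrow> x \<in> f ` C" "\<And>q. q \<in> C \<Longrightarrow> \<bar>f q\<bar> \<le> h"
    for f :: "square \<Rightarrow> int"
  proof -
    have sub: "progression 2 e (- real_of_int h) h \<subseteq> f ` C"
    proof
      fix x assume "x \<in> progression 2 e (- real_of_int h) h"
      hence "x mod 2 = e" "\<bar>x\<bar> \<le> h" by (auto simp: progression_def)
      with f(1)[of x] show "x \<in> f ` C" by simp
    qed
    have "(\<Sum>t\<in>progression 2 e (- real_of_int h) h. w\<^sub>x t) \<le> (\<Sum>t\<in>f ` C. w\<^sub>x t)"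
      by (rule sum_mono2) (use finite_queens sub f(2) x_nonneg in auto)
    also have "\<dots> \<le> (\<Sum>q\<in>C. w\<^sub>x (f q))"
      using sum_image_le[of C w\<^sub>x f] finite_queens f(2) x_nonneg by (simp add: o_def)
    finally show ?thesis .
  qed
  have cols: "(\<Sum>t\<in>progression 2 e (- real_of_int h) h. w\<^sub>x t) \<le> (\<Sum>q\<in>C. w\<^sub>x (fst q))"
    by (rule line[OF columns]) (use board in auto)
  have rows: "(\<Sum>t\<in>progression 2 e (- real_of_int h) h. w\<^sub>x t) \<le> (\<Sum>q\<in>C. w\<^sub>x (snd q))"
    by (rule line[OF rows]) (use board in auto)
  have "(\<Sum>t\<in>?D\<^sub>0. a\<^sub>0 t) + (\<Sum>t\<in>?D\<^sub>2. a\<^sub>2 t) = (\<Sum>t\<in>?D\<^sub>0. w\<^sub>d t) + (\<Sum>t\<in>?D\<^sub>2. w\<^sub>d t)"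
    using distinct by (intro arg_cong2[of _ _ _ _ "(+)"] sum.cong) (auto simp: progression_def w\<^sub>d_def)
  also have "\<dots> = (\<Sum>t\<in>?D\<^sub>0 \<union> ?D\<^sub>2. w\<^sub>d t)"
    using distinct by (intro sum.union_disjoint[symmetric]) (simp, simp, auto simp: progression_def)
  also have "\<dots> \<le> (\<Sum>q\<in>C. w\<^sub>d (difference q)) + 0 * M"
  proof (rule sum_le_sum_occupied[OF finite_queens])
    show "real (card (?D\<^sub>0 \<union> ?D\<^sub>2 - difference ` C)) \<le> 0"
    proof -
      have "?D\<^sub>0 \<union> ?D\<^sub>2 - difference ` C = {}" using D by auto
      thus ?thesis by (simp only: card.empty)
    qed
    show "w\<^sub>d t \<le> M" if "t \<in> ?D\<^sub>0 \<union> ?D\<^sub>2" for t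
    proof -
      have "\<bar>t\<bar> \<le> 2 * h" using that assms(2-4) by (auto simp: progression_def)
      with le[of t] M show ?thesis by (simp add: w\<^sub>d_def)
    qed
  qed (use nonneg difference_bound M in \<open>auto simp: w\<^sub>d_def\<close>)
  finally have diffs: "(\<Sum>t\<in>?D\<^sub>0. a\<^sub>0 t) + (\<Sum>t\<in>?D\<^sub>2. a\<^sub>2 t) \<le> (\<Sum>q\<in>C. w\<^sub>d (difference q))" by simp
  have "(\<Sum>t\<in>?S\<^sub>0. a\<^sub>0 t) + (\<Sum>t\<in>?S\<^sub>2. a\<^sub>2 t) = (\<Sum>t\<in>?S\<^sub>0. w\<^sub>s t) + (\<Sum>t\<in>?S\<^sub>2. w\<^sub>s t)"
    using distinct by (intro arg_cong2[of _ _ _ _ "(+)"] sum.cong) (auto simp: progression_def w\<^sub>s_def)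
  also have "\<dots> = (\<Sum>t\<in>?S\<^sub>0 \<union> ?S\<^sub>2. w\<^sub>s t)"
    using distinct by (intro sum.union_disjoint[symmetric]) (simp, simp, auto simp: progression_def)
  also have "\<dots> \<le> (\<Sum>q\<in>C. w\<^sub>s (total q)) + 4 * real_of_int excess * M"
  proof (rule sum_le_sum_occupied[OF finite_queens])
    have "card (?S\<^sub>0 \<union> ?S\<^sub>2 - total ` C) \<le> card (?S\<^sub>0 - total ` C) + card (?S\<^sub>2 - total ` C)"
      by (metis Un_Diff card_Un_le)
    with S show "real (card (?S\<^sub>0 \<union> ?S\<^sub>2 - total ` C)) \<le> 4 * real_of_int excess" by linarith
    show "w\<^sub>s t \<le> M" if "t \<in> ?S\<^sub>0 \<union> ?S\<^sub>2" for t
    proof -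
      have "\<bar>t\<bar> \<le> 2 * h" using that assms(2-4) by (auto simp: progression_def)
      with le[of t] M show ?thesis by (simp add: w\<^sub>s_def)
    qed
  qed (use nonneg total_bound M in \<open>auto simp: w\<^sub>s_def\<close>)
  finally have tots: "(\<Sum>t\<in>?S\<^sub>0. a\<^sub>0 t) + (\<Sum>t\<in>?S\<^sub>2. a\<^sub>2 t)
      \<le> (\<Sum>q\<in>C. w\<^sub>s (total q)) + 4 * real_of_int excess * M" .
  have d_eq: "\<And>t. t mod 4 = c \<Longrightarrow> w\<^sub>d t = a\<^sub>0 t"
    "\<And>t. t mod 4 = (c + 2) mod 4 \<Longrightarrow> w\<^sub>d t = a\<^sub>2 t"
    "\<And>t. \<lbrakk>t mod 4 \<noteq> c; t mod 4 \<noteq> (c + 2) mod 4\<rbrakk> \<Longrightarrow> w\<^sub>d t = 0"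
    unfolding w\<^sub>d_def by (metis distinct(1))+
  have s_eq: "\<And>t. t mod 4 = (2 * e - c) mod 4 \<Longrightarrow> w\<^sub>s t = a\<^sub>0 t"
    "\<And>t. t mod 4 = (2 * e + 2 - c) mod 4 \<Longrightarrow> w\<^sub>s t = a\<^sub>2 t"
    "\<And>t. \<lbrakk>t mod 4 \<noteq> (2 * e - c) mod 4; t mod 4 \<noteq> (2 * e + 2 - c) mod 4\<rbrakk> \<Longrightarrow> w\<^sub>s t = 0"
    unfolding w\<^sub>s_def by (metis distinct(2))+
  have queen: "w\<^sub>x (fst q) + w\<^sub>x (snd q) + w\<^sub>d (difference q) + w\<^sub>s (total q)
      \<le> \<kappa> + (if fst q mod 2 \<noteq> e then \<nu> else 0)" if "q \<in> C" for q
  proof -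
    obtain x y where q: "q = (x, y)" by (cases q)
    have xy: "\<bar>x\<bar> \<le> h" "\<bar>y\<bar> \<le> h" using board that q by auto
    have b: "\<bar>y - x\<bar> \<le> 2 * h" "\<bar>x + y\<bar> \<le> 2 * h" using xy by linarith+
    have "w\<^sub>x x + w\<^sub>x y + w\<^sub>d (y - x) + w\<^sub>s (x + y) \<le> \<kappa> + (if x mod 2 \<noteq> e then \<nu> else 0)"
      using square_types[OF c e, of x y]
    proof (elim disjE conjE)
      assume x: "x mod 2 = e" and d: "(y - x) mod 4 = c" and s: "(x + y) mod 4 = (2 * e - c) mod 4"
      show ?thesis using right(1)[OF xy] x \<open>0 \<le> \<nu>\<close> unfolding d_eq(1)[OF d] s_eq(1)[OF s] by simp
    next
      assume x: "x mod 2 = e" and d: "(y - x) mod 4 = (c + 2) mod 4" and s: "(x + y) mod 4 = (2 * e + 2 - c) mod 4"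
      show ?thesis using right(2)[OF xy] x \<open>0 \<le> \<nu>\<close> unfolding d_eq(2)[OF d] s_eq(2)[OF s] by simp
    next
      assume x: "x mod 2 \<noteq> e" and d: "(y - x) mod 4 = c" and s: "(x + y) mod 4 = (2 * e + 2 - c) mod 4"
      show ?thesis using wrong(1)[OF xy] x \<open>0 \<le> \<nu>\<close> unfolding d_eq(1)[OF d] s_eq(2)[OF s] by simp
    next
      assume x: "x mod 2 \<noteq> e" and d: "(y - x) mod 4 = (c + 2) mod 4" and s: "(x + y) mod 4 = (2 * e - c) mod 4"
      show ?thesis using wrong(2)[OF xy] x \<open>0 \<le> \<nu>\<close> unfolding d_eq(2)[OF d] s_eq(1)[OF s] by simp
    next
      assume d: "(y - x) mod 4 \<noteq> c" "(y - x) mod 4 \<noteq> (c + 2) mod 4"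
        and s: "(x + y) mod 4 \<noteq> (2 * e - c) mod 4" "(x + y) mod 4 \<noteq> (2 * e + 2 - c) mod 4"
      show ?thesis using right(1)[OF xy] nonneg(1)[OF b(1)] nonneg(1)[OF b(2)] \<open>0 \<le> \<nu>\<close>
        unfolding d_eq(3)[OF d] s_eq(3)[OF s] by simp
    qed
    thus ?thesis by (simp add: q difference_def total_def)
  qed
  have "(\<Sum>q\<in>C. w\<^sub>x (fst q) + w\<^sub>x (snd q) + w\<^sub>d (difference q) + w\<^sub>s (total q))
      \<le> (\<Sum>q\<in>C. \<kappa> + (if fst q mod 2 \<noteq> e then \<nu> else 0))"
    by (rule sum_mono) (rule queen)
  also have "\<dots> = \<kappa> * card C + \<nu> * card {q\<in>C. fst q mod 2 \<noteq> e}"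
    using finite_queens by (simp add: sum.distrib sum.If_cases Int_def)
  also have "real (card C) = real_of_int (h + excess)" by (simp add: excess_def)
  also have "\<nu> * card {q\<in>C. fst q mod 2 \<noteq> e} \<le> \<nu> * excess"
    using card_wrong_parity[OF columns] \<open>0 \<le> \<nu>\<close> by (intro mult_left_mono) linarith+
  finally show ?thesis using cols rows diffs tots by (simp add: sum.distrib)
qed

end

section \<open>Total weights of the occupied lines\<close>

lemma sum_symmetric_quadratic_ge:
  fixes w c :: int and R W \<alpha> \<beta> :: real
  assumes w: "w > 0" "0 \<le> c" "c < w" "(- c) mod w = c"
    and "0 \<le> R" "R \<le> W" "W > 0"
    and nonneg: "\<And>t. \<bar>t\<bar> \<le> R \<Longrightarrow> 0 \<le> \<alpha> + \<beta> * (t / W)\<^sup>2"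
  shows "2 * (\<alpha> * R + \<beta> * R ^ 3 / (3 * W\<^sup>2)) - 2 * (w * (\<bar>\<alpha>\<bar> + 3 * \<bar>\<beta>\<bar>))
    \<le> w * (\<Sum>t\<in>progression w c (- R) R. \<alpha> + \<beta> * (of_int t / W)\<^sup>2)"
proof -
  let ?q = "\<lambda>t :: int. \<alpha> + \<beta> * (of_int t / W)\<^sup>2"
  have wp: "real_of_int w > 0" using w by simp
  have "\<alpha> * (R - 0) + \<beta> * W / 3 * ((R / W - 0) ^ 3 - (0 / W - 0) ^ 3)
      - w * (2 * \<bar>\<beta>\<bar> / W * (R - 0) + (\<bar>\<alpha>\<bar> + \<bar>\<beta>\<bar>))
      \<le> w * (\<Sum>t\<in>progression w c 0 R. \<alpha> + \<beta> * (of_int t / W - 0)\<^sup>2)"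
    by (rule sum_quadratic_progression_ge[OF w(1-3)]) (use assms in auto)
  moreover have "2 * \<bar>\<beta>\<bar> / W * R \<le> 2 * \<bar>\<beta>\<bar>"
    using assms(5-7) by (simp add: field_simps mult_right_mono)
  hence "w * (2 * \<bar>\<beta>\<bar> / W * R + (\<bar>\<alpha>\<bar> + \<bar>\<beta>\<bar>)) \<le> w * (\<bar>\<alpha>\<bar> + 3 * \<bar>\<beta>\<bar>)"
    using wp by (intro mult_left_mono) auto
  moreover have "\<beta> * W / 3 * (R / W) ^ 3 = \<beta> * R ^ 3 / (3 * W\<^sup>2)"
    using \<open>W > 0\<close> by (simp add: field_simps power2_eq_square power3_eq_cube)
  ultimately have "\<alpha> * R + \<beta> * R ^ 3 / (3 * W\<^sup>2) - w * (\<bar>\<alpha>\<bar> + 3 * \<bar>\<beta>\<bar>)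
      \<le> w * (\<Sum>t\<in>progression w c 0 R. ?q t)" by simp
  moreover have "w * (2 * (\<Sum>t\<in>progression w c 0 R. ?q t)) \<le> w * (\<Sum>t\<in>progression w c (- R) R. ?q t)"
    using wp assms by (intro mult_left_mono sum_progression_symmetric) (auto simp: progression_def intro!: nonneg)
  ultimately show ?thesis by (simp add: algebra_simps)
qed

lemma sum_squares_ge:
  fixes c :: int and h R :: real
  assumes c: "0 \<le> c" "c < 4" "(- c) mod 4 = c" and "0 < h" "0 \<le> R" "R \<le> 2 * h"
  shows "R ^ 3 / 6 - 24 * h\<^sup>2 \<le> (\<Sum>t\<in>progression 4 c (- R) R. (of_int t)\<^sup>2)"
proof -
  have "2 * (0 * R + (2 * h)\<^sup>2 * R ^ 3 / (3 * (2 * h)\<^sup>2)) - 2 * (real_of_int 4 * (\<bar>0\<bar> + 3 * \<bar>(2 * h)\<^sup>2\<bar>))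
      \<le> real_of_int 4 * (\<Sum>t\<in>progression 4 c (- R) R. 0 + (2 * h)\<^sup>2 * (of_int t / (2 * h))\<^sup>2)"
    by (rule sum_symmetric_quadratic_ge) (use assms in auto)
  thus ?thesis using \<open>0 < h\<close> by (simp add: field_simps)
qed

lemma sum_co_squares_ge:
  fixes c :: int and h R :: real
  assumes c: "0 \<le> c" "c < 4" "(- c) mod 4 = c" and "0 < h" "0 \<le> R" "R \<le> 2 * h"
  shows "2 * h\<^sup>2 * R - R ^ 3 / 6 - 32 * h\<^sup>2 \<le> (\<Sum>t\<in>progression 4 c (- R) R. 4 * h\<^sup>2 - (of_int t)\<^sup>2)"
proof -
  have "2 * ((2 * h)\<^sup>2 * R + (- (2 * h)\<^sup>2) * R ^ 3 / (3 * (2 * h)\<^sup>2)) - 2 * (real_of_int 4 * (\<bar>(2 * h)\<^sup>2\<bar> + 3 * \<bar>- (2 * h)\<^sup>2\<bar>))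
      \<le> real_of_int 4 * (\<Sum>t\<in>progression 4 c (- R) R. (2 * h)\<^sup>2 + (- (2 * h)\<^sup>2) * (of_int t / (2 * h))\<^sup>2)"
  proof (rule sum_symmetric_quadratic_ge)
    show "0 \<le> (2 * h)\<^sup>2 + (- (2 * h)\<^sup>2) * (t / (2 * h))\<^sup>2" if "\<bar>t\<bar> \<le> R" for t
    proof -
      have "\<bar>t\<bar>\<^sup>2 \<le> (2 * h)\<^sup>2" using that assms by (intro power_mono) auto
      thus ?thesis using \<open>0 < h\<close> by (simp add: power_divide)
    qed
  qed (use assms in auto)
  thus ?thesis using \<open>0 < h\<close> by (simp add: field_simps)
qed

lemma sum_line_squares_ge:
  fixes e :: int and h :: real
  assumes e: "e \<in> {0, 1}" and "0 < h"
  shows "2 * h ^ 3 / 3 - 12 * h\<^sup>2 \<le> (\<Sum>t\<in>progression 2 e (- h) h. 2 * (of_int t)\<^sup>2)"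
proof -
  have main: "2 * (0 * h + (2 * h\<^sup>2) * h ^ 3 / (3 * h\<^sup>2)) - 2 * (real_of_int 2 * (\<bar>0\<bar> + 3 * \<bar>2 * h\<^sup>2\<bar>))
      \<le> real_of_int 2 * (\<Sum>t\<in>progression 2 e (- h) h. 0 + (2 * h\<^sup>2) * (of_int t / h)\<^sup>2)"
    by (rule sum_symmetric_quadratic_ge) (use assms in auto)
  have eqs: "(2 * h\<^sup>2) * h ^ 3 / (3 * h\<^sup>2) = 2 / 3 * h ^ 3"
    "0 + (2 * h\<^sup>2) * (of_int t / h)\<^sup>2 = 2 * (of_int t)\<^sup>2" for t :: int
    using \<open>0 < h\<close> by (simp_all add: field_simps)
  show ?thesis using main unfolding eqs by simp
qed

lemma sum_line_co_squares_ge: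
  fixes e :: int and h :: real
  assumes e: "e \<in> {0, 1}" and "0 < h"
  shows "4 * h ^ 3 / 3 - 16 * h\<^sup>2 \<le> (\<Sum>t\<in>progression 2 e (- h) h. 2 * h\<^sup>2 - 2 * (of_int t)\<^sup>2)"
proof -
  have "2 * ((2 * h\<^sup>2) * h + (- 2 * h\<^sup>2) * h ^ 3 / (3 * h\<^sup>2)) - 2 * (real_of_int 2 * (\<bar>2 * h\<^sup>2\<bar> + 3 * \<bar>- 2 * h\<^sup>2\<bar>))
      \<le> real_of_int 2 * (\<Sum>t\<in>progression 2 e (- h) h. (2 * h\<^sup>2) + (- 2 * h\<^sup>2) * (of_int t / h)\<^sup>2)"
  proof (rule sum_symmetric_quadratic_ge)
    show "0 \<le> (2 * h\<^sup>2) + (- 2 * h\<^sup>2) * (t / h)\<^sup>2" if "\<bar>t\<bar> \<le> h" for t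
    proof -
      have "\<bar>t\<bar>\<^sup>2 \<le> h\<^sup>2" using that assms by (intro power_mono) auto
      thus ?thesis using \<open>0 < h\<close> by (simp add: power_divide)
    qed
  qed (use assms in auto)
  thus ?thesis using \<open>0 < h\<close> by (simp add: field_simps power2_eq_square power3_eq_cube)
qed

lemma sum_narrow_potential_ge:
  fixes c :: int and R W :: real
  assumes c: "0 \<le> c" "c < 4" "(- c) mod 4 = c" and "0 < W" "0 \<le> R" "R \<le> W"
  shows "14 * R - 9/2 * (R ^ 3 / W\<^sup>2) - 218 \<le> (\<Sum>t\<in>progression 4 c (- R) R. narrow_potential (of_int t / W))"
proof -
  have "2 * (28 * R + (- 27) * R ^ 3 / (3 * W\<^sup>2)) - 2 * (real_of_int 4 * (\<bar>28\<bar> + 3 * \<bar>- 27\<bar>))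
      \<le> real_of_int 4 * (\<Sum>t\<in>progression 4 c (- R) R. 28 + (- 27) * (of_int t / W)\<^sup>2)"
  proof (rule sum_symmetric_quadratic_ge)
    show "0 \<le> 28 + (- 27) * (t / W)\<^sup>2" if "\<bar>t\<bar> \<le> R" for t
    proof -
      have "\<bar>t / W\<bar> \<le> 1" using that assms by simp
      hence "(t / W)\<^sup>2 \<le> 1" by (simp only: abs_square_le_1)
      thus ?thesis by simp
    qed
  qed (use assms in auto)
  also have "\<dots> \<le> real_of_int 4 * (\<Sum>t\<in>progression 4 c (- R) R. narrow_potential (of_int t / W))"
    by (intro mult_left_mono sum_mono) (auto simp: narrow_potential_def)
  finally show ?thesis by simp
qed

lemma sum_wide_potential_ge:
  fixes c :: int and W :: real
  assumes c: "0 \<le> c" "c < 4" "(- c) mod 4 = c" and W: "0 < W"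
  shows "607 / 36 * W - 284 \<le> (\<Sum>t\<in>progression 4 c (- (2 * W)) (2 * W). wide_potential (of_int t / W))"
proof -
  let ?s = "\<lambda>l r. \<Sum>t\<in>progression 4 c l r. wide_potential (of_int t / W)"
  have "14 * (5/6 * W - 0) + 9 * W / 3 * ((5/6 * W / W - 0) ^ 3 - (0 / W - 0) ^ 3)
      - real_of_int 4 * (2 * \<bar>9\<bar> / W * (5/6 * W - 0) + (\<bar>14\<bar> + \<bar>9\<bar>))
      \<le> real_of_int 4 * (\<Sum>t\<in>progression 4 c 0 (5/6 * W). 14 + 9 * (of_int t / W - 0)\<^sup>2)"
    by (rule sum_quadratic_progression_ge) (use assms in auto)
  also have "\<dots> = 4 * ?s 0 (5/6 * W)"
    using W by (auto simp: progression_def wide_potential_def field_simps intro!: sum.cong)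
  finally have 1: "14 * (5/6 * W) + 125/72 * W - 152 \<le> 4 * ?s 0 (5/6 * W)"
    using W by (simp add: power3_eq_cube)
  have "21 * (7/6 * W - 5/6 * W) + (- 27) * W / 3 * ((7/6 * W / W - 1) ^ 3 - (5/6 * W / W - 1) ^ 3)
      - real_of_int 4 * (2 * \<bar>- 27\<bar> / W * (7/6 * W - 5/6 * W) + (\<bar>21\<bar> + \<bar>- 27\<bar>))
      \<le> real_of_int 4 * (\<Sum>t\<in>progression 4 c (5/6 * W) (7/6 * W). 21 + (- 27) * (of_int t / W - 1)\<^sup>2)"
  proof (rule sum_quadratic_progression_ge)
    show "0 \<le> 21 + (- 27) * (t / W - 1)\<^sup>2" if "5/6 * W \<le> t" "t \<le> 7/6 * W" for t
    proof -
      have "5/6 \<le> t / W" "t / W \<le> 7/6" using that W by (simp_all add: field_simps)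
      hence "\<bar>t / W - 1\<bar> \<le> 1/6" by linarith
      hence "\<bar>t / W - 1\<bar>\<^sup>2 \<le> (1/6)\<^sup>2" by (intro power_mono) auto
      hence "(t / W - 1)\<^sup>2 \<le> 1/36" by (simp add: power_divide)
      thus ?thesis by linarith
    qed
  qed (use assms in auto)
  also have "\<dots> = 4 * ?s (5/6 * W) (7/6 * W)"
    using W by (auto simp: progression_def wide_potential_def field_simps intro!: sum.cong)
  finally have 2: "7 * W - W / 12 - 264 \<le> 4 * ?s (5/6 * W) (7/6 * W)"
    using W by (simp add: power3_eq_cube field_simps)
  have "14 * (2 * W - 7/6 * W) + 9 * W / 3 * ((2 * W / W - 2) ^ 3 - (7/6 * W / W - 2) ^ 3)
      - real_of_int 4 * (2 * \<bar>9\<bar> / W * (2 * W - 7/6 * W) + (\<bar>14\<bar> + \<bar>9\<bar>))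
      \<le> real_of_int 4 * (\<Sum>t\<in>progression 4 c (7/6 * W) (2 * W). 14 + 9 * (of_int t / W - 2)\<^sup>2)"
    by (rule sum_quadratic_progression_ge) (use assms in auto)
  also have "\<dots> = 4 * ?s (7/6 * W) (2 * W)"
    using W by (auto simp: progression_def wide_potential_def field_simps intro!: sum.cong)
  finally have 3: "14 * (5/6 * W) + 125/72 * W - 152 \<le> 4 * ?s (7/6 * W) (2 * W)"
    using W by (simp add: power3_eq_cube field_simps)
  have "?s 0 (5/6 * W) + ?s (5/6 * W) (2 * W) \<le> ?s 0 (2 * W)"
    "?s (5/6 * W) (7/6 * W) + ?s (7/6 * W) (2 * W) \<le> ?s (5/6 * W) (2 * W)"
    using W by (auto intro!: sum_progression_split wide_potential_nonneg)
  moreover have "2 * ?s 0 (2 * W) \<le> ?s (- (2 * W)) (2 * W)"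
  proof (rule sum_progression_symmetric)
    show "wide_potential (of_int (- t) / W) = wide_potential (of_int t / W)" for t
      by (simp add: wide_potential_def)
  qed (use assms in \<open>auto simp: wide_potential_nonneg\<close>)
  ultimately show ?thesis using 1 2 3 by simp
qed

text \<open>
  The main term is the integral of \<open>line_potential\<close> from \<open>0\<close> to \<open>h / W\<close>, times \<open>W\<close>.
\<close>

lemma sum_line_potential_ge:
  fixes e :: int and h W :: real
  assumes e: "e \<in> {0, 1}" and W: "0 < W" "W \<le> h" "h \<le> 3/2 * W"
  shows "2/3 * W + 14 * (h - W/3) - 6 * W * ((h / W - 1) ^ 3 + 8/27) - 328
    \<le> (\<Sum>t\<in>progression 2 e (- h) h. line_potential (of_int t / W))"
proof -
  let ?s = "\<lambda>l r. \<Sum>t\<in>progression 2 e l r. line_potential (of_int t / W)"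
  have "0 * (W/3 - 0) + 54 * W / 3 * ((W/3 / W - 0) ^ 3 - (0 / W - 0) ^ 3)
      - real_of_int 2 * (2 * \<bar>54\<bar> / W * (W/3 - 0) + (\<bar>0\<bar> + \<bar>54\<bar>))
      \<le> real_of_int 2 * (\<Sum>t\<in>progression 2 e 0 (W/3). 0 + 54 * (of_int t / W - 0)\<^sup>2)"
    by (rule sum_quadratic_progression_ge) (use assms in auto)
  also have "\<dots> = 2 * ?s 0 (W/3)"
    using W by (auto simp: progression_def line_potential_def field_simps intro!: sum.cong)
  finally have 1: "2/3 * W - 180 \<le> 2 * ?s 0 (W/3)"
    using W by (simp add: power3_eq_cube)
  define u where "u = 36 / W * (h - W/3)"
  have "14 * (h - W/3) + (- 18) * W / 3 * ((h / W - 1) ^ 3 - (W/3 / W - 1) ^ 3)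
      - real_of_int 2 * (2 * \<bar>- 18\<bar> / W * (h - W/3) + (\<bar>14\<bar> + \<bar>- 18\<bar>))
      \<le> real_of_int 2 * (\<Sum>t\<in>progression 2 e (W/3) h. 14 + (- 18) * (of_int t / W - 1)\<^sup>2)"
  proof (rule sum_quadratic_progression_ge)
    show "0 \<le> 14 + (- 18) * (t / W - 1)\<^sup>2" if "W/3 \<le> t" "t \<le> h" for t
    proof -
      have "t \<le> 3/2 * W" using that W by linarith
      hence "1/3 \<le> t / W" "t / W \<le> 3/2" using that W by (simp_all add: field_simps)
      hence "\<bar>t / W - 1\<bar> \<le> 2/3" by linarith
      hence "\<bar>t / W - 1\<bar>\<^sup>2 \<le> (2/3)\<^sup>2" by (intro power_mono) auto
      hence "(t / W - 1)\<^sup>2 \<le> 4/9" by (simp add: power_divide)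
      thus ?thesis by linarith
    qed
    show "\<bar>h / W - 1\<bar> \<le> 1" using W by (simp add: abs_le_iff field_simps)
  qed (use assms in auto)
  also have "\<dots> = 2 * ?s (W/3) h"
    using W by (auto simp: progression_def line_potential_def field_simps intro!: sum.cong)
  also have "(W/3 / W - 1) ^ 3 = - (8/27)" using W by (simp add: power3_eq_cube)
  finally have "14 * (h - W/3) - 6 * W * ((h / W - 1) ^ 3 + 8/27) - 2 * u - 64 \<le> 2 * ?s (W/3) h"
    by (simp add: u_def)
  moreover have "u \<le> 42" using W by (simp add: u_def field_simps)
  ultimately have 2: "14 * (h - W/3) - 6 * W * ((h / W - 1) ^ 3 + 8/27) - 148 \<le> 2 * ?s (W/3) h"
    by linarith
  have nonneg: "0 \<le> line_potential (of_int t / W)" if "t \<in> progression 2 e (- h) h" for t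
  proof (rule line_potential_nonneg)
    have "\<bar>real_of_int t\<bar> \<le> 3/2 * W" using that W by (auto simp: progression_def abs_le_iff)
    thus "\<bar>real_of_int t / W\<bar> \<le> 3/2" using W by (simp add: field_simps)
  qed
  have "?s 0 (W/3) + ?s (W/3) h \<le> ?s 0 h"
    using W by (intro sum_progression_split nonneg) (auto simp: progression_def)
  moreover have "2 * ?s 0 h \<le> ?s (- h) h"
  proof (rule sum_progression_symmetric)
    show "line_potential (of_int (- t) / W) = line_potential (of_int t / W)" for t
      by (simp add: line_potential_def)
    show "(- e) mod 2 = e" using e by auto
  qed (use nonneg W in auto)
  ultimately show ?thesis using 1 2 by linarith
qed

text \<open>
  With \<open>y + z = 1\<close> exactly, \<open>y\<^sup>3 + z\<^sup>3 = 1 - 3 y (1 - y)\<close> would decrease to its minimum at \<open>y = 1/2\<close> and increase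
  afterwards, and equal \<open>1/2\<close> near \<open>y = 0.7887\<close>. The tolerances are those that arise for \<open>k \<le> h / 40000\<close> and
  \<open>h \<ge> 200000\<close>. The upper bound for \<open>y\<close> has to be sharp, because the gap in the next lemma falls below \<open>0.035\<close> just beyond
  \<open>0.789\<close>.
\<close>

lemma radius_bounds:
  fixes y z :: real
  assumes "0 \<le> z" "z \<le> y" "y + z \<le> 1" "1 - 27/200000 \<le> y + z"
    and upper: "y ^ 3 + z ^ 3 \<le> 1/2 + 43/100000" and lower: "1/2 - 1/1000 \<le> y ^ 3 + z ^ 3"
  shows "74/100 \<le> y" "y \<le> 789/1000"
proof -
  have cubes: "y ^ 3 + (s - y) ^ 3 = s ^ 3 - 3 * s * (y * (s - y))" for s :: real
    by (simp add: power3_eq_cube algebra_simps)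
  show "74/100 \<le> y"
  proof (rule ccontr)
    assume "\<not> 74/100 \<le> y"
    moreover have "49/100 \<le> y" using assms by linarith
    ultimately have "0 \<le> (y - 49/100) * (74/100 - y)" by (intro mult_nonneg_nonneg) auto
    hence "1924/10000 \<le> y * (1 - y)" using \<open>\<not> 74/100 \<le> y\<close> by (simp add: algebra_simps)
    moreover have "z ^ 3 \<le> (1 - y) ^ 3" using assms by (intro power_mono) auto
    ultimately show False using lower cubes[of 1] by simp
  qed
  show "y \<le> 789/1000"
  proof (rule ccontr)
    assume y: "\<not> y \<le> 789/1000"
    define s :: real where "s = 1 - 27/200000"
    have "s ^ 3 - 3 * s * (789/1000 * (s - 789/1000)) \<le> y ^ 3 + z ^ 3"
    proof (cases "s \<le> y")
      case True
      have "s ^ 3 \<le> y ^ 3" using True by (intro power_mono) (auto simp: s_def)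
      moreover have "0 \<le> z ^ 3" using assms by simp
      moreover have "0 \<le> 3 * s * (789/1000 * (s - 789/1000))" by (simp add: s_def)
      ultimately show ?thesis by linarith
    next
      case False
      have "0 \<le> (y - 789/1000) * (y - (s - 789/1000))"
        using y by (intro mult_nonneg_nonneg) (auto simp: s_def)
      hence "y * (s - y) \<le> 789/1000 * (s - 789/1000)" by (simp add: algebra_simps)
      hence "3 * s * (y * (s - y)) \<le> 3 * s * (789/1000 * (s - 789/1000))"
        by (intro mult_left_mono) (auto simp: s_def)
      moreover have "(s - y) ^ 3 \<le> z ^ 3" using False assms by (intro power_mono) (auto simp: s_def)
      ultimately show ?thesis using cubes[of s] by linarith
    qed
    with upper show False by (simp add: s_def power3_eq_cube)
  qed
qed

text \<open>
  After multiplication by \<open>y\<^sup>2\<close> a cubic has to be nonnegative between \<open>0.74\<close> and \<open>0.789\<close>. It is the sum of its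
  linear interpolant at the two ends, which is positive, and a product \<open>P\<close> of three factors that are nonnegative
  there.
\<close>

lemma potential_gap:
  fixes y :: real
  assumes "74/100 \<le> y" "y \<le> 789/1000"
  shows "35/1000 \<le> 28 - 203/6 * y - 84 * (1 - y) ^ 3 / y\<^sup>2"
proof -
  define m :: real where "m = 883981/6000"
  define P where "P = (y - 74/100) * (789/1000 - y) * (m - 301/6 * y)"
  have "0 \<le> P" unfolding P_def m_def using assms by (intro mult_nonneg_nonneg) auto
  moreover have "(28 - 35/1000) * y\<^sup>2 - 203/6 * y ^ 3 - 84 * (1 - y) ^ 3
      = P + (252 - m * (1529/1000) - 301/6 * (58386/100000)) * y + (m * (58386/100000) - 84)"
    by (simp add: P_def m_def field_simps power2_eq_square power3_eq_cube)
  moreover have "0 \<le> (252 - m * (1529/1000) - 301/6 * (58386/100000)) * y + (m * (58386/100000) - 84)"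
    using assms by (simp add: m_def)
  ultimately have "0 \<le> (28 - 35/1000) * y\<^sup>2 - 203/6 * y ^ 3 - 84 * (1 - y) ^ 3" by linarith
  thus ?thesis using assms by (simp add: field_simps power2_eq_square power3_eq_cube)
qed

section \<open>The lower bound\<close>

lemma even_residue:
  fixes a :: int
  assumes "even a"
  shows "0 \<le> a mod 4" "a mod 4 < 4" "(- (a mod 4)) mod 4 = a mod 4"
proof -
  obtain b where "a = 2 * b" using assms by blast
  thus "(- (a mod 4)) mod 4 = a mod 4" by presburger
qed simp_all

lemma class_residues:
  fixes c e :: int
  assumes "c \<in> {0, 2}"
  shows "0 \<le> c" "c < 4" "(- c) mod 4 = c"
    and "0 \<le> (c + 2) mod 4" "(c + 2) mod 4 < 4" "(- ((c + 2) mod 4)) mod 4 = (c + 2) mod 4"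
    and "0 \<le> (2 * e - c) mod 4" "(2 * e - c) mod 4 < 4"
      "(- ((2 * e - c) mod 4)) mod 4 = (2 * e - c) mod 4"
    and "0 \<le> (2 * e + 2 - c) mod 4" "(2 * e + 2 - c) mod 4 < 4"
      "(- ((2 * e + 2 - c) mod 4)) mod 4 = (2 * e + 2 - c) mod 4"
  using assms by (auto intro!: even_residue(3))

context centred_cover
begin

text \<open>
  The weights \<open>t\<^sup>2\<close> on diagonals with \<open>2 h\<^sup>2 - 2 t\<^sup>2\<close> on columns and rows, and the complementary weights
  \<open>4 h\<^sup>2 - t\<^sup>2\<close> with \<open>2 t\<^sup>2\<close>: by the parallelogram law every square weighs exactly \<open>4 h\<^sup>2\<close>, respectively
  \<open>8 h\<^sup>2\<close>.
\<close>

lemma radii_cubes: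
  fixes c R\<^sub>0 R\<^sub>2 :: int
  assumes c: "c \<in> {0, 2}" and R: "0 \<le> R\<^sub>2" "R\<^sub>2 \<le> R\<^sub>0" "R\<^sub>0 \<le> 2 * h"
    and occupied: "progression 4 c (- real_of_int R\<^sub>0) R\<^sub>0 \<subseteq> difference ` C"
      "progression 4 ((c + 2) mod 4) (- real_of_int R\<^sub>2) R\<^sub>2 \<subseteq> difference ` C"
      "int (card (progression 4 ((2 * e - c) mod 4) (- real_of_int R\<^sub>0) R\<^sub>0 - total ` C)) \<le> 2 * excess"
      "int (card (progression 4 ((2 * e + 2 - c) mod 4) (- real_of_int R\<^sub>2) R\<^sub>2 - total ` C)) \<le> 2 * excess"
  defines "H \<equiv> real_of_int h" and "k \<equiv> real_of_int excess"
    and "r\<^sub>0 \<equiv> real_of_int R\<^sub>0" and "r\<^sub>2 \<equiv> real_of_int R\<^sub>2"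
  shows "r\<^sub>0 ^ 3 + r\<^sub>2 ^ 3 \<le> 4 * H ^ 3 + (60 * k + 384) * H\<^sup>2"
    and "12 * H\<^sup>2 * (r\<^sub>0 + r\<^sub>2) \<le> 20 * H ^ 3 + r\<^sub>0 ^ 3 + r\<^sub>2 ^ 3 + (72 * k + 456) * H\<^sup>2"
proof -
  note c0 = class_residues(1-3)[OF c] and c2 = class_residues(4-6)[OF c]
    and s0 = class_residues(7-9)[OF c, of e] and s2 = class_residues(10-12)[OF c, of e]
  have H: "0 < H" using h_pos by (simp add: H_def)
  have r: "0 \<le> r\<^sub>0" "r\<^sub>0 \<le> 2 * H" "0 \<le> r\<^sub>2" "r\<^sub>2 \<le> 2 * H" using R by (auto simp: H_def r\<^sub>0_def r\<^sub>2_def)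
  have sq: "(real_of_int t)\<^sup>2 \<le> m\<^sup>2" if "\<bar>real_of_int t\<bar> \<le> m" for t m
    using power_mono[OF that, of 2] by simp
  have sq2: "(real_of_int t)\<^sup>2 \<le> 4 * H\<^sup>2" if "\<bar>t\<bar> \<le> 2 * h" for t
    using sq[of t "2 * H"] that by (simp add: H_def flip: of_int_abs)
  have sq1: "(real_of_int t)\<^sup>2 \<le> H\<^sup>2" if "\<bar>t\<bar> \<le> h" for t
    using sq[of t H] that by (simp add: H_def flip: of_int_abs)
  have weights: "2 * (\<Sum>t\<in>progression 2 e (- H) H. 2 * H\<^sup>2 - 2 * (real_of_int t)\<^sup>2)
      + (\<Sum>t\<in>progression 4 c (- r\<^sub>0) r\<^sub>0. (real_of_int t)\<^sup>2)
      + (\<Sum>t\<in>progression 4 ((c + 2) mod 4) (- r\<^sub>2) r\<^sub>2. (real_of_int t)\<^sup>2)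
      + (\<Sum>t\<in>progression 4 ((2 * e - c) mod 4) (- r\<^sub>0) r\<^sub>0. (real_of_int t)\<^sup>2)
      + (\<Sum>t\<in>progression 4 ((2 * e + 2 - c) mod 4) (- r\<^sub>2) r\<^sub>2. (real_of_int t)\<^sup>2)
      \<le> 4 * H\<^sup>2 * real_of_int (h + excess) + 0 * real_of_int excess + 4 * real_of_int excess * (4 * H\<^sup>2)"
    unfolding H_def r\<^sub>0_def r\<^sub>2_def
    by (rule weighted_count[OF c R occupied])
       (use sq1 sq2 in \<open>auto simp: H_def power2_eq_square algebra_simps\<close>)
  have arith: "r\<^sub>0 ^ 3 + r\<^sub>2 ^ 3 \<le> 4 * H ^ 3 + (60 * k + 384) * H\<^sup>2"
    if "2 * L + A + B + A' + B' \<le> 4 * H\<^sup>2 * real_of_int (h + excess) + 0 * real_of_int excess + 4 * real_of_int excess * (4 * H\<^sup>2)"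
      "4 * H ^ 3 / 3 - 16 * H\<^sup>2 \<le> L" "r\<^sub>0 ^ 3 / 6 - 24 * H\<^sup>2 \<le> A" "r\<^sub>2 ^ 3 / 6 - 24 * H\<^sup>2 \<le> B"
      "r\<^sub>0 ^ 3 / 6 - 24 * H\<^sup>2 \<le> A'" "r\<^sub>2 ^ 3 / 6 - 24 * H\<^sup>2 \<le> B'" for L A A' B B' :: real
  proof -
    have total: "4 * H\<^sup>2 * real_of_int (h + excess) + 0 * real_of_int excess + 4 * real_of_int excess * (4 * H\<^sup>2)
        = 4 * H ^ 3 + 20 * (k * H\<^sup>2)"
      by (simp add: H_def k_def algebra_simps power2_eq_square power3_eq_cube)
    have "(60 * k + 384) * H\<^sup>2 = 60 * (k * H\<^sup>2) + 384 * H\<^sup>2" by (simp add: ring_distribs)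
    thus ?thesis using that(1)[unfolded total] that(2-6) by argo
  qed
  show "r\<^sub>0 ^ 3 + r\<^sub>2 ^ 3 \<le> 4 * H ^ 3 + (60 * k + 384) * H\<^sup>2"
    by (rule arith[OF weights sum_line_co_squares_ge[OF e H] sum_squares_ge[OF c0 H r(1,2)]
      sum_squares_ge[OF c2 H r(3,4)] sum_squares_ge[OF s0 H r(1,2)] sum_squares_ge[OF s2 H r(3,4)]])
  have weights: "2 * (\<Sum>t\<in>progression 2 e (- H) H. 2 * (real_of_int t)\<^sup>2)
      + (\<Sum>t\<in>progression 4 c (- r\<^sub>0) r\<^sub>0. 4 * H\<^sup>2 - (real_of_int t)\<^sup>2)
      + (\<Sum>t\<in>progression 4 ((c + 2) mod 4) (- r\<^sub>2) r\<^sub>2. 4 * H\<^sup>2 - (real_of_int t)\<^sup>2)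
      + (\<Sum>t\<in>progression 4 ((2 * e - c) mod 4) (- r\<^sub>0) r\<^sub>0. 4 * H\<^sup>2 - (real_of_int t)\<^sup>2)
      + (\<Sum>t\<in>progression 4 ((2 * e + 2 - c) mod 4) (- r\<^sub>2) r\<^sub>2. 4 * H\<^sup>2 - (real_of_int t)\<^sup>2)
      \<le> 8 * H\<^sup>2 * real_of_int (h + excess) + 0 * real_of_int excess + 4 * real_of_int excess * (4 * H\<^sup>2)"
    unfolding H_def r\<^sub>0_def r\<^sub>2_def
    by (rule weighted_count[OF c R occupied])
       (use sq1 sq2 in \<open>auto simp: H_def power2_eq_square algebra_simps\<close>)
  have arith: "12 * H\<^sup>2 * (r\<^sub>0 + r\<^sub>2) \<le> 20 * H ^ 3 + r\<^sub>0 ^ 3 + r\<^sub>2 ^ 3 + (72 * k + 456) * H\<^sup>2"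
    if "2 * L + A + B + A' + B' \<le> 8 * H\<^sup>2 * real_of_int (h + excess) + 0 * real_of_int excess + 4 * real_of_int excess * (4 * H\<^sup>2)"
      "2 * H ^ 3 / 3 - 12 * H\<^sup>2 \<le> L"
      "2 * H\<^sup>2 * r\<^sub>0 - r\<^sub>0 ^ 3 / 6 - 32 * H\<^sup>2 \<le> A" "2 * H\<^sup>2 * r\<^sub>2 - r\<^sub>2 ^ 3 / 6 - 32 * H\<^sup>2 \<le> B"
      "2 * H\<^sup>2 * r\<^sub>0 - r\<^sub>0 ^ 3 / 6 - 32 * H\<^sup>2 \<le> A'" "2 * H\<^sup>2 * r\<^sub>2 - r\<^sub>2 ^ 3 / 6 - 32 * H\<^sup>2 \<le> B'"
    for L A A' B B' :: real
  proof -
    have total: "8 * H\<^sup>2 * real_of_int (h + excess) + 0 * real_of_int excess + 4 * real_of_int excess * (4 * H\<^sup>2)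
        = 8 * H ^ 3 + 24 * (k * H\<^sup>2)"
      by (simp add: H_def k_def algebra_simps power2_eq_square power3_eq_cube)
    have "(72 * k + 456) * H\<^sup>2 = 72 * (k * H\<^sup>2) + 456 * H\<^sup>2" by (simp add: ring_distribs)
    moreover have "12 * H\<^sup>2 * (r\<^sub>0 + r\<^sub>2) = 12 * (H\<^sup>2 * r\<^sub>0) + 12 * (H\<^sup>2 * r\<^sub>2)"
      by (simp add: ring_distribs)
    ultimately show ?thesis using that(1)[unfolded total] that(2-6) by argo
  qed
  show "12 * H\<^sup>2 * (r\<^sub>0 + r\<^sub>2) \<le> 20 * H ^ 3 + r\<^sub>0 ^ 3 + r\<^sub>2 ^ 3 + (72 * k + 456) * H\<^sup>2"
    by (rule arith[OF weights sum_line_squares_ge[OF e H] sum_co_squares_ge[OF c0 H r(1,2)]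
      sum_co_squares_ge[OF c2 H r(3,4)] sum_co_squares_ge[OF s0 H r(1,2)] sum_co_squares_ge[OF s2 H r(3,4)]])
qed

text \<open>
  The bound on \<open>W\<close> keeps the board inside the range where all potentials are nonnegative and \<open>wide_potential\<close> is
  at most 21. A queen with both coordinates of the wrong parity therefore weighs at most
  \<open>21 + 28 + 14 + 14 = 56 + 21\<close>.
\<close>

lemma potential_count:
  fixes c R\<^sub>0 R\<^sub>2 :: int
  assumes c: "c \<in> {0, 2}" and R: "0 \<le> R\<^sub>2" "R\<^sub>2 \<le> R\<^sub>0" "R\<^sub>0 \<le> 2 * h"
    and occupied: "progression 4 c (- real_of_int R\<^sub>0) R\<^sub>0 \<subseteq> difference ` C"
      "progression 4 ((c + 2) mod 4) (- real_of_int R\<^sub>2) R\<^sub>2 \<subseteq> difference ` C"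
      "int (card (progression 4 ((2 * e - c) mod 4) (- real_of_int R\<^sub>0) R\<^sub>0 - total ` C)) \<le> 2 * excess"
      "int (card (progression 4 ((2 * e + 2 - c) mod 4) (- real_of_int R\<^sub>2) R\<^sub>2 - total ` C)) \<le> 2 * excess"
  defines "H \<equiv> real_of_int h" and "k \<equiv> real_of_int excess"
    and "W \<equiv> real_of_int R\<^sub>0 / 2" and "r\<^sub>2 \<equiv> real_of_int R\<^sub>2"
  assumes W: "74/100 * H \<le> W" and r2: "r\<^sub>2 \<le> W"
  shows "2 * (2/3 * W + 14 * (H - W/3) - 6 * W * ((H / W - 1) ^ 3 + 8/27)) + 607/18 * W
      + 28 * r\<^sub>2 - 9 * (r\<^sub>2 ^ 3 / W\<^sup>2) \<le> 56 * H + 189 * k + 1660"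
proof -
  note c0 = class_residues(1-3)[OF c] and c2 = class_residues(4-6)[OF c]
    and s0 = class_residues(7-9)[OF c, of e] and s2 = class_residues(10-12)[OF c, of e]
  have H: "0 < H" using h_pos by (simp add: H_def)
  have Wh: "0 < W" "W \<le> H" "H \<le> 3/2 * W" using W H R by (auto simp: W_def H_def)
  have r0: "real_of_int R\<^sub>0 = 2 * W" by (simp add: W_def)
  have near: "\<bar>real_of_int t / W\<bar> \<le> 3/2" if "\<bar>t\<bar> \<le> h" for t
  proof -
    have "\<bar>real_of_int t\<bar> \<le> H" using that by (simp add: H_def flip: of_int_abs)
    also have "\<dots> \<le> 3/2 * W" by (rule Wh)
    finally show ?thesis using Wh(1) by (simp add: field_simps)
  qed
  have far: "wide_potential (real_of_int t / W) \<le> 21" if "\<bar>t\<bar> \<le> 2 * h" for t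
  proof (rule wide_potential_le)
    have "\<bar>real_of_int t\<bar> \<le> 2 * H" using that by (simp add: H_def flip: of_int_abs)
    also have "\<dots> \<le> 14/5 * W" using W H by simp
    finally show "\<bar>real_of_int t / W\<bar> \<le> 14/5" using Wh(1) by (simp add: field_simps)
  qed
  have weights: "2 * (\<Sum>t\<in>progression 2 e (- H) H. line_potential (real_of_int t / W))
      + (\<Sum>t\<in>progression 4 c (- (2 * W)) (2 * W). wide_potential (real_of_int t / W))
      + (\<Sum>t\<in>progression 4 ((c + 2) mod 4) (- r\<^sub>2) r\<^sub>2. narrow_potential (real_of_int t / W))
      + (\<Sum>t\<in>progression 4 ((2 * e - c) mod 4) (- (2 * W)) (2 * W). wide_potential (real_of_int t / W))
      + (\<Sum>t\<in>progression 4 ((2 * e + 2 - c) mod 4) (- r\<^sub>2) r\<^sub>2. narrow_potential (real_of_int t / W))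
      \<le> 56 * real_of_int (h + excess) + 21 * real_of_int excess + 4 * real_of_int excess * 28"
    unfolding r0[symmetric] H_def r\<^sub>2_def
  proof (rule weighted_count[OF c R occupied])
    fix x y :: int assume xy: "\<bar>x\<bar> \<le> h" "\<bar>y\<bar> \<le> h"
    hence b: "\<bar>y - x\<bar> \<le> 2 * h" "\<bar>x + y\<bar> \<le> 2 * h" by linarith+
    have split: "real_of_int (y - x) / W = y / W - x / W" "real_of_int (x + y) / W = x / W + y / W"
      by (simp_all add: diff_divide_distrib add_divide_distrib)
    show "wide_potential (real_of_int (y - x) / W) + wide_potential (real_of_int (x + y) / W)
        + line_potential (real_of_int x / W) + line_potential (real_of_int y / W) \<le> 56"
      unfolding split by (rule wide_potential_balance)
    show "narrow_potential (real_of_int (y - x) / W) + narrow_potential (real_of_int (x + y) / W)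
        + line_potential (real_of_int x / W) + line_potential (real_of_int y / W) \<le> 56"
      unfolding split by (rule narrow_potential_balance)
    note le = line_potential_le[of "real_of_int x / W"] line_potential_le[of "real_of_int y / W"]
    show "wide_potential (real_of_int (y - x) / W) + narrow_potential (real_of_int (x + y) / W)
        + line_potential (real_of_int x / W) + line_potential (real_of_int y / W) \<le> 56 + 21"
      using far[OF b(1)] narrow_potential_le[of "real_of_int (x + y) / W"] le by linarith
    show "narrow_potential (real_of_int (y - x) / W) + wide_potential (real_of_int (x + y) / W)
        + line_potential (real_of_int x / W) + line_potential (real_of_int y / W) \<le> 56 + 21"
      using far[OF b(2)] narrow_potential_le[of "real_of_int (y - x) / W"] le by linarith
  next
    show "wide_potential (real_of_int t / W) \<le> 28" if "\<bar>t\<bar> \<le> 2 * h" for t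
      using far[OF that] by linarith
  qed (auto intro: near line_potential_nonneg wide_potential_nonneg narrow_potential_nonneg narrow_potential_le)
  have arith: ?thesis
    if "2 * L + A + B + A' + B' \<le> 56 * real_of_int (h + excess) + 21 * real_of_int excess + 4 * real_of_int excess * 28"
      "2/3 * W + 14 * (H - W/3) - 6 * W * ((H / W - 1) ^ 3 + 8/27) - 328 \<le> L"
      "607/36 * W - 284 \<le> A" "14 * r\<^sub>2 - 9/2 * (r\<^sub>2 ^ 3 / W\<^sup>2) - 218 \<le> B"
      "607/36 * W - 284 \<le> A'" "14 * r\<^sub>2 - 9/2 * (r\<^sub>2 ^ 3 / W\<^sup>2) - 218 \<le> B'"
    for L A A' B B' :: real
  proof -
    define l q where "l = 2/3 * W + 14 * (H - W/3) - 6 * W * ((H / W - 1) ^ 3 + 8/27)"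
      and "q = r\<^sub>2 ^ 3 / W\<^sup>2"
    have total: "56 * real_of_int (h + excess) + 21 * real_of_int excess + 4 * real_of_int excess * 28 = 56 * H + 189 * k"
      by (simp add: H_def k_def)
    have "2 * l + 607/18 * W + 28 * r\<^sub>2 - 9 * q \<le> 56 * H + 189 * k + 1660"
      using that(1)[unfolded total] that(2-6)[folded l_def q_def] by linarith
    thus ?thesis by (simp only: l_def q_def)
  qed
  have r: "0 \<le> r\<^sub>2" using R by (simp add: r\<^sub>2_def)
  show ?thesis
    by (rule arith[OF weights sum_line_potential_ge[OF e Wh] sum_wide_potential_ge[OF c0 Wh(1)]
      sum_narrow_potential_ge[OF c2 Wh(1) r r2] sum_wide_potential_ge[OF s0 Wh(1)]
      sum_narrow_potential_ge[OF s2 Wh(1) r r2]])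
qed

text \<open>
  If \<open>k \<le> h / 40000\<close>, the first system of weights confines the ratio \<open>y = R\<^sub>0 / (2 h)\<close> and the second then yields
  \<open>0.035 h \<le> 1772 + 469 k\<close>, which is false for \<open>h \<ge> 200000\<close>.
\<close>

lemma excess_large:
  assumes h: "200000 \<le> h"
  shows "h < 40000 * excess"
proof (rule ccontr)
  assume "\<not> h < 40000 * excess"
  define H k where "H = real_of_int h" and "k = real_of_int excess"
  have H: "200000 \<le> H" using h by (simp add: H_def)
  have k: "0 \<le> k" "40000 * k \<le> H"
    using excess_nonneg \<open>\<not> h < 40000 * excess\<close> unfolding H_def k_def by linarith+
  obtain c R\<^sub>0 R\<^sub>2 :: int where c: "c \<in> {0, 2}" and R: "0 \<le> R\<^sub>2" "R\<^sub>2 \<le> R\<^sub>0"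
    and R_sum: "2 * h - 10 * excess - 4 \<le> R\<^sub>0 + R\<^sub>2" "R\<^sub>0 + R\<^sub>2 \<le> 2 * h"
    and occupied: "progression 4 c (- real_of_int R\<^sub>0) R\<^sub>0 \<subseteq> difference ` C"
      "progression 4 ((c + 2) mod 4) (- real_of_int R\<^sub>2) R\<^sub>2 \<subseteq> difference ` C"
      "int (card (progression 4 ((2 * e - c) mod 4) (- real_of_int R\<^sub>0) R\<^sub>0 - total ` C)) \<le> 2 * excess"
      "int (card (progression 4 ((2 * e + 2 - c) mod 4) (- real_of_int R\<^sub>2) R\<^sub>2 - total ` C)) \<le> 2 * excess"
    by (rule occupied_radii)
  have R0: "R\<^sub>0 \<le> 2 * h" using R R_sum by linarith
  define y z where "y = R\<^sub>0 / (2 * H)" and "z = R\<^sub>2 / (2 * H)"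
  have Rr: "real_of_int R\<^sub>0 = 2 * H * y" "real_of_int R\<^sub>2 = 2 * H * z" using H by (simp_all add: y_def z_def)
  have sum: "2 * H - 10 * k - 4 \<le> 2 * H * y + 2 * H * z" "2 * H * y + 2 * H * z \<le> 2 * H"
    using R_sum unfolding Rr[symmetric] unfolding H_def k_def by linarith+
  have zy: "0 \<le> z" "z \<le> y" using R H by (simp_all add: y_def z_def divide_right_mono)
  have yz: "y + z \<le> 1"
  proof -
    have "2 * H * (y + z) \<le> 2 * H * 1" using sum(2) by (simp add: ring_distribs)
    thus ?thesis using H by (subst (asm) mult_le_cancel_left_pos) auto
  qed
  have yz': "1 - 27/200000 \<le> y + z"
  proof -
    have "2 * H * (1 - 27/200000) \<le> 2 * H * (y + z)" using sum(1) k H by (simp add: ring_distribs)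
    thus ?thesis using H by (subst (asm) mult_le_cancel_left_pos) auto
  qed
  note cubes = radii_cubes[OF c R R0 occupied, folded H_def k_def, unfolded Rr]
  have slack: "k * H\<^sup>2 \<le> H ^ 3 / 40000" "H\<^sup>2 \<le> H ^ 3 / 200000"
    using mult_right_mono[of "40000 * k" H "H\<^sup>2"] mult_right_mono[of 200000 H "H\<^sup>2"] k H
    by (simp_all add: power2_eq_square power3_eq_cube)
  have H3: "0 < 8 * H ^ 3" using H by simp
  have upper: "y ^ 3 + z ^ 3 \<le> 1/2 + 43/100000"
  proof -
    have "8 * H ^ 3 * (y ^ 3 + z ^ 3) \<le> 4 * H ^ 3 + 60 * (k * H\<^sup>2) + 384 * H\<^sup>2"
      using cubes(1) by (simp add: power_mult_distrib ring_distribs)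
    also have "\<dots> \<le> 4 * H ^ 3 + 344/100000 * H ^ 3" using slack H3 by linarith
    also have "\<dots> = 8 * H ^ 3 * (1/2 + 43/100000)" by simp
    finally show ?thesis using H3 by (subst (asm) mult_le_cancel_left_pos) auto
  qed
  have lower: "1/2 - 1/1000 \<le> y ^ 3 + z ^ 3"
  proof -
    have "12 * H\<^sup>2 * (2 * H - 10 * k - 4) \<le> 12 * H\<^sup>2 * (2 * H * y + 2 * H * z)"
      using sum(1) by (intro mult_left_mono) auto
    also have "\<dots> \<le> 20 * H ^ 3 + 8 * H ^ 3 * (y ^ 3 + z ^ 3) + 72 * (k * H\<^sup>2) + 456 * H\<^sup>2"
      using cubes(2) by (simp add: power_mult_distrib ring_distribs)
    also have "12 * H\<^sup>2 * (2 * H - 10 * k - 4) = 24 * H ^ 3 - 120 * (k * H\<^sup>2) - 48 * H\<^sup>2"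
      by (simp add: algebra_simps power2_eq_square power3_eq_cube)
    finally have "4 * H ^ 3 - 192 * (k * H\<^sup>2) - 504 * H\<^sup>2 \<le> 8 * H ^ 3 * (y ^ 3 + z ^ 3)" by simp
    moreover have "8 * H ^ 3 * (1/2 - 1/1000) = 4 * H ^ 3 - 8/1000 * H ^ 3" by simp
    ultimately have "8 * H ^ 3 * (1/2 - 1/1000) \<le> 8 * H ^ 3 * (y ^ 3 + z ^ 3)" using slack H3 by linarith
    thus ?thesis using H3 by (subst (asm) mult_le_cancel_left_pos) auto
  qed
  note y = radius_bounds[OF zy yz yz' upper lower]
  define q where "q = (1 - y) ^ 3 / y\<^sup>2"
  have W: "real_of_int R\<^sub>0 / 2 = y * H" using H by (simp add: y_def)
  have y0: "0 < y" using y by simp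
  have r2: "2 * H * z \<le> y * H"
  proof -
    have "2 * z \<le> y" using yz y by simp
    thus ?thesis using H by simp
  qed
  have count: "2 * (2/3 * (y * H) + 14 * (H - y * H / 3) - 6 * (y * H) * ((H / (y * H) - 1) ^ 3 + 8/27))
      + 607/18 * (y * H) + 28 * (2 * H * z) - 9 * ((2 * H * z) ^ 3 / (y * H)\<^sup>2) \<le> 56 * H + 189 * k + 1660"
    by (rule potential_count[OF c R R0 occupied, folded H_def k_def, unfolded W Rr(2)])
       (use y(1) H r2 in auto)
  have outer: "y * H * (H / (y * H) - 1) ^ 3 = H * q"
  proof -
    have "H / (y * H) - 1 = (1 - y) / y" using H y0 by (simp add: field_simps)
    thus ?thesis using y0 by (simp add: q_def power_divide power2_eq_square power3_eq_cube)
  qed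
  have narrow: "(2 * H * z) ^ 3 / (y * H)\<^sup>2 \<le> 8 * (H * q)"
  proof -
    have "z ^ 3 \<le> (1 - y) ^ 3" using yz zy by (intro power_mono) auto
    hence "H * (z ^ 3 / y\<^sup>2) \<le> H * q"
      using H by (auto simp: q_def intro!: mult_left_mono divide_right_mono)
    moreover have "(2 * H * z) ^ 3 / (y * H)\<^sup>2 = 8 * (H * (z ^ 3 / y\<^sup>2))"
      using H y0 by (simp add: field_simps power2_eq_square power3_eq_cube)
    ultimately show ?thesis by simp
  qed
  have arith: "28 * H - 203/6 * V - 84 * Q \<le> 1772 + 469 * k"
    if "2 * (2/3 * V + 14 * (H - V / 3) - 6 * V * (D + 8/27)) + 607/18 * V + 28 * Z - 9 * T \<le> 56 * H + 189 * k + 1660"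
      "V * D = Q" "T \<le> 8 * Q" "2 * H - 10 * k - 4 \<le> 2 * V + Z" for V Z D T Q :: real
  proof -
    have outer: "6 * V * (D + 8/27) = 6 * Q + 16/9 * V" using that(2) by (simp add: algebra_simps)
    show ?thesis using that(1)[unfolded outer] that(3,4) by argo
  qed
  have "28 * H - 203/6 * (y * H) - 84 * (H * q) \<le> 1772 + 469 * k"
    by (rule arith[OF count outer narrow]) (use sum(1) in \<open>simp add: mult_ac\<close>)
  moreover have "H * (35/1000) \<le> H * (28 - 203/6 * y - 84 * q)"
    using potential_gap[OF y] H unfolding q_def by (intro mult_left_mono) auto
  ultimately have "35/1000 * H \<le> 1772 + 469 * k" by (simp add: algebra_simps)
  with k H show False by simp
qed

end

theorem theorem2p2:
  fixes n :: nat and p :: int and C :: "square set"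
  assumes "n \<ge> 400001" and "odd n"
    and "p \<in> {0, 1}"
    and "relaxed_cover n p C"
  shows "real (card C) > c1 * (real n - 1) - 1 / 5"
proof -
  obtain m where m: "n = 2 * m + 1" using \<open>odd n\<close> by (rule oddE)
  define h e where "h = int m" and "e = (p - h) mod 2"
  have n: "int n = 2 * h + 1" by (simp add: h_def m)
  define shift where "shift = (\<lambda>q :: square. (fst q - h, snd q - h))"
  have inj: "inj_on shift A" for A by (auto simp: inj_on_def shift_def prod_eq_iff)
  have dom: "C \<subseteq> squares n" "\<And>v. v \<in> squares n \<Longrightarrow> v \<in> C \<or> (\<exists>c\<in>C. queen_adj n v c)"
    and col: "\<And>x. \<lbrakk>0 \<le> x; x < int n; x mod 2 = p\<rbrakk> \<Longrightarrow> column_occupied C x"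
    and row: "\<And>y. \<lbrakk>0 \<le> y; y < int n; y mod 2 = p\<rbrakk> \<Longrightarrow> row_occupied C y"
    using assms(4) by (auto simp: relaxed_cover_def dominating_set_def)
  have parity: "(x + h) mod 2 = p" if "x mod 2 = e" for x
    using that \<open>p \<in> {0, 1}\<close> unfolding e_def by (elim insertE emptyE; simp; presburger)
  interpret centred_cover h e "shift ` C"
  proof
    show "0 < h" using assms(1) m by (simp add: h_def)
    show "e \<in> {0, 1}" unfolding e_def by auto
    have "finite (squares n)" by (simp add: squares_def)
    thus "finite (shift ` C)" using dom(1) by (auto intro: finite_subset)
    show "\<bar>x\<bar> \<le> h \<and> \<bar>y\<bar> \<le> h" if xy: "(x, y) \<in> shift ` C" for x y
    proof -
      obtain q where "q \<in> C" "(x, y) = shift q" using xy by blast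
      moreover from this have "q \<in> squares n" using dom(1) by blast
      ultimately show ?thesis using n by (auto simp: shift_def squares_def)
    qed
    show "x \<in> fst ` shift ` C" if x: "\<bar>x\<bar> \<le> h" "x mod 2 = e" for x
    proof -
      have "column_occupied C (x + h)" using x n by (intro col parity) auto
      then obtain y where "(x + h, y) \<in> C" by (auto simp: column_occupied_def)
      thus ?thesis by (force simp: shift_def)
    qed
    show "y \<in> snd ` shift ` C" if y: "\<bar>y\<bar> \<le> h" "y mod 2 = e" for y
    proof -
      have "row_occupied C (y + h)" using y n by (intro row parity) auto
      then obtain x where "(x, y + h) \<in> C" by (auto simp: row_occupied_def)
      thus ?thesis by (force simp: shift_def)
    qed
    show "x \<in> fst ` shift ` C \<or> y \<in> snd ` shift ` C \<or> y - x \<in> difference ` shift ` C \<or> x + y \<in> total ` shift ` C"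
      if xy: "\<bar>x\<bar> \<le> h" "\<bar>y\<bar> \<le> h" for x y
    proof -
      have "(x + h, y + h) \<in> squares n" using xy n by (auto simp: squares_def)
      then obtain c where c: "c \<in> C" "c = (x + h, y + h) \<or> queen_adj n (x + h, y + h) c"
        using dom(2) by blast
      have "x = fst (shift c) \<or> y = snd (shift c) \<or> y - x = difference (shift c) \<or> x + y = total (shift c)"
        using c(2) by (auto simp: queen_adj_def shift_def difference_def total_def)
      with c(1) show ?thesis by blast
    qed
  qed
  have "200000 \<le> h" using assms(1) m by (simp add: h_def)
  hence "h < 40000 * excess" by (rule excess_large)
  moreover have "card (shift ` C) = card C" by (rule card_image[OF inj])
  ultimately have "40001 * h < 40000 * int (card C)" by (simp add: excess_def)
  hence "40001 * real m < 40000 * real (card C)" unfolding h_def by linarith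
  thus ?thesis by (simp add: m c1_def)
qed

end
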